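(* Let $R, S, \iota, G$ satisfy the standing assumptions (A1)–(A4) listed in the context, and let $p,m$ be positive integers. Then the function $d_\nu$ on pairs of elements of $\mathbb{S}(R,p,m)$ defined in the context is a metric on the set $\mathbb{S}(R,p,m)$.
   Context: Standing assumptions. (A1) $R$ is a commutative integral domain with identity. (A2) $S$ is a unital commutative complex semisimple Banach algebra with an involution $\cdot^*$, such that $R\subset S$. $\mathrm{inv}\,S$ denotes the set of invertible elements of $S$. (A3) There is a map $\iota:\mathrm{inv}\,S\to G$, where $(G,+)$ is an Abelian group with identity $\circ$, such that: (I1) $\iota(ab)=\iota(a)+\iota(b)$ for $a,b\in \mathrm{inv}\,S$; (I2) $\iota(a^* )=-\iota(a)$ for $a\in\mathrm{inv}\,S$; (I3) $\iota$ is locally constant, i.e. continuous when $G$ has the discrete topology. (A4) An element $x\in R\cap \mathrm{inv}\,S$ is invertible as an element of $R$ if and only if $\iota(x)=\circ$. Notation. $\mathbb{F}(R)$ is the field of fractions of $R$. For a matrix $F$ with entries in $R$, $F^*$ is the matrix over $S$ with $(i,j)$ entry $(F_{ji})^*$. For $P\in \mathbb{F}(R)^{p\times m}$, a factorization $P=ND^{-1}$ with $N,D$ matrices over $R$ is a right coprime factorization if there are matrices $X,Y$ over $R$ with $XN+YD=I_m$; it is normalized if moreover $N^*N+D^*D=I_m$. A factorization $P=\widetilde D^{-1}\widetilde N$ with $\widetilde N,\widetilde D$ matrices over $R$ is a left coprime factorization if there are matrices $\widetilde X,\widetilde Y$ over $R$ with $\widetilde N\widetilde X+\widetilde D\widetilde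 Y=I_p$; it is normalized if moreover $\widetilde N\widetilde N^*+\widetilde D\widetilde D^*=I_p$. $\mathbb{S}(R,p,m)$ is the set of all $P\in\mathbb{F}(R)^{p\times m}$ possessing both a normalized right and a normalized left coprime factorization. For $P_i\in\mathbb S(R,p,m)$ with normalized factorizations $P_i=N_iD_i^{-1}=\widetilde D_i^{-1}\widetilde N_i$, put $G_i=\begin{bmatrix}N_i\\ D_i\end{bmatrix}$ and $\widetilde G_i=\begin{bmatrix}-\widetilde D_i&\widetilde N_i\end{bmatrix}$. $\mathfrak M$ is the maximal ideal space of $S$. For a matrix $M$ over $S$, $\mathbf{M}$ denotes its entrywise Gelfand transform and $\|M\|_\infty=\max_{\varphi\in\mathfrak M}\|\mathbf M(\varphi)\|$, where $\|\cdot\|$ is the operator norm induced by Euclidean norms. Definition of $d_\nu$: for $P_1,P_2\in\mathbb{S}(R,p,m)$ with normalized left/right coprime factorizations and the associated $G_1,\widetilde G_1,G_2,\widetilde G_2$, $$d_\nu(P_1,P_2)=\begin{cases}\|\widetilde G_2G_1\|_\infty&\text{if }\det(G_1^*G_2)\in\mathrm{inv}\,S\text{ and }\iota(\det(G_1^*G_2))=\circ,\\ 1&\text{otherwise.}\end{cases}$$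
   Formalization: The involution on S is additionally assumed symmetric: φ(a* ) is the complex conjugate of φ(a) for every φ in the maximal ideal space. For a general involution the triangle inequality can fail, e.g. for (a,b)* = (conj b, conj a) on C×C with R = {(a, conj a)}. *)

theory Defs
  imports
    "HOL-Analysis.Analysis"
    "HOL-Computational_Algebra.Fraction_Field"
    "HOL-Algebra.Ideal"
    "HOL-Decision_Procs.Algebra_Aux"
begin

section \<open>Commutative complex Banach algebras\<close>

text \<open>The library only has real normed algebras. The first axiom makes the complex scalar
  multiplication extend the real one; the norm of the identity is 1 by \<open>real_normed_algebra_1\<close>.\<close>

class complex_comm_banach_algebra_1 = real_normed_algebra_1 + comm_ring_1 + banach +
  fixes scaleC :: "complex \<Rightarrow> 'a \<Rightarrow> 'a"
  assumes scaleC_of_real: "scaleC (complex_of_real r) x = scaleR r x"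
    and scaleC_add_right: "scaleC c (x + y) = scaleC c x + scaleC c y"
    and scaleC_add_left: "scaleC (c + d) x = scaleC c x + scaleC d x"
    and scaleC_scaleC: "scaleC c (scaleC d x) = scaleC (c * d) x"
    and mult_scaleC_left: "scaleC c x * y = scaleC c (x * y)"
    and norm_scaleC: "norm (scaleC c x) = cmod c * norm x"

definition semisimple_algebra :: "'s::complex_comm_banach_algebra_1 itself \<Rightarrow> bool" where
  "semisimple_algebra _ \<longleftrightarrow> \<Inter> {I::'s set. maximalideal I cring_class_ops} = {0}"

definition inv_elems :: "'a::comm_ring_1 set" where
  "inv_elems = {a. a dvd 1}"

text \<open>Points of the maximal ideal space are represented, as usual, by the nonzero complex algebra
  homomorphisms (each maximal ideal is the kernel of exactly one of them). They are automatically
  continuous.\<close>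

definition max_ideal_space :: "('s::complex_comm_banach_algebra_1 \<Rightarrow> complex) set" where
  "max_ideal_space = {\<phi>. (\<forall>x y. \<phi> (x + y) = \<phi> x + \<phi> y) \<and> (\<forall>c x. \<phi> (scaleC c x) = c * \<phi> x) \<and>
     (\<forall>x y. \<phi> (x * y) = \<phi> x * \<phi> y) \<and> (\<exists>x. \<phi> x \<noteq> 0)}"

text \<open>\<open>map_matrix \<phi> M\<close> is the value at \<open>\<phi>\<close> of the Gelfand transform of \<open>M\<close>. The norm on
  \<open>complex ^ 'n\<close> is Euclidean, so \<open>onorm\<close> is the induced operator norm. The supremum is attained,
  since the maximal ideal space is compact.\<close>

definition matrix_norm_inf :: "'s::complex_comm_banach_algebra_1 ^ 'n::finite ^ 'k::finite \<Rightarrow> real" where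
  "matrix_norm_inf M = (SUP \<phi>\<in>max_ideal_space. onorm ((*v) (map_matrix \<phi> M)))"

section \<open>Involutions\<close>

locale algebra_involution =
  fixes star :: "'s::complex_comm_banach_algebra_1 \<Rightarrow> 's"
  assumes star_add: "star (x + y) = star x + star y"
    and star_scaleC: "star (scaleC c x) = scaleC (cnj c) (star x)"
    and star_mult: "star (x * y) = star y * star x"
    and star_star: "star (star x) = x"

text \<open>Compatibility of the involution with the Gelfand transform, which makes the transform of
  \<open>M\<^sup>*\<close> the pointwise Hermitian adjoint of the transform of \<open>M\<close>. It does not follow from the
  algebraic laws: \<open>(a, b) \<mapsto> (cnj b, cnj a)\<close> on \<open>\<complex> \<times> \<complex>\<close> violates it, and with this
  involution the triangle inequality for the nu-metric fails.\<close>

definition symmetric_involution :: "('s::complex_comm_banach_algebra_1 \<Rightarrow> 's) \<Rightarrow> bool" where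
  "symmetric_involution star \<longleftrightarrow> (\<forall>\<phi>\<in>max_ideal_space. \<forall>x. \<phi> (star x) = cnj (\<phi> x))"

definition matrix_star :: "('s \<Rightarrow> 's) \<Rightarrow> 's ^ 'n::finite ^ 'k::finite \<Rightarrow> 's ^ 'k ^ 'n" where
  "matrix_star star F = (\<chi> i j. star (F $ j $ i))"

section \<open>The abstract setting\<close>

text \<open>The inclusion of the domain \<open>R\<close> in \<open>S\<close> is an injective unital ring homomorphism \<open>emb\<close>, so
  that \<open>R\<close> is a type and its field of fractions is \<open>'r fract\<close>. Only the values of \<open>\<iota>\<close> on
  invertible elements are constrained or used.\<close>

locale nu_metric_setting = algebra_involution star
  for star :: "'s::complex_comm_banach_algebra_1 \<Rightarrow> 's" +
  fixes emb :: "'r::idom \<Rightarrow> 's"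
    and \<iota> :: "'s \<Rightarrow> 'g::ab_group_add"
  assumes emb_add: "emb (x + y) = emb x + emb y"
    and emb_mult: "emb (x * y) = emb x * emb y"
    and emb_one: "emb 1 = 1"
    and emb_inj: "inj emb"
    and semisimple: "semisimple_algebra TYPE('s)"
    and index_mult: "\<lbrakk>a \<in> inv_elems; b \<in> inv_elems\<rbrakk> \<Longrightarrow> \<iota> (a * b) = \<iota> a + \<iota> b"
    and index_star: "a \<in> inv_elems \<Longrightarrow> \<iota> (star a) = - \<iota> a"
    and index_continuous: "continuous_map (top_of_set inv_elems) (discrete_topology UNIV) \<iota>"
    and inv_iff_index: "emb x \<in> inv_elems \<Longrightarrow> x \<in> inv_elems \<longleftrightarrow> \<iota> (emb x) = 0"

section \<open>Normalized coprime factorizations\<close>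

definition fract_matrix :: "'r::idom ^ 'n::finite ^ 'k::finite \<Rightarrow> 'r fract ^ 'n ^ 'k" where
  "fract_matrix = map_matrix (\<lambda>x. Fract x 1)"

definition right_coprime_factorization ::
    "'r::idom fract ^ 'm::finite ^ 'p::finite \<Rightarrow> 'r ^ 'm ^ 'p \<Rightarrow> 'r ^ 'm ^ 'm \<Rightarrow> bool" where
  "right_coprime_factorization P N D \<longleftrightarrow>
     invertible (fract_matrix D) \<and> P = fract_matrix N ** matrix_inv (fract_matrix D) \<and>
     (\<exists>X Y. X ** N + Y ** D = mat 1)"

definition left_coprime_factorization ::
    "'r::idom fract ^ 'm::finite ^ 'p::finite \<Rightarrow> 'r ^ 'm ^ 'p \<Rightarrow> 'r ^ 'p ^ 'p \<Rightarrow> bool" where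
  "left_coprime_factorization P N D \<longleftrightarrow>
     invertible (fract_matrix D) \<and> P = matrix_inv (fract_matrix D) ** fract_matrix N \<and>
     (\<exists>X Y. N ** X + D ** Y = mat 1)"

definition normalized_right_factorization ::
    "('s::complex_comm_banach_algebra_1 \<Rightarrow> 's) \<Rightarrow> ('r::idom \<Rightarrow> 's) \<Rightarrow>
     'r fract ^ 'm::finite ^ 'p::finite \<Rightarrow> 'r ^ 'm ^ 'p \<Rightarrow> 'r ^ 'm ^ 'm \<Rightarrow> bool" where
  "normalized_right_factorization star emb P N D \<longleftrightarrow>
     right_coprime_factorization P N D \<and>
     matrix_star star (map_matrix emb N) ** map_matrix emb N +
     matrix_star star (map_matrix emb D) ** map_matrix emb D = mat 1"

definition normalized_left_factorization ::
    "('s::complex_comm_banach_algebra_1 \<Rightarrow> 's) \<Rightarrow> ('r::idom \<Rightarrow> 's) \<Rightarrow>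
     'r fract ^ 'm::finite ^ 'p::finite \<Rightarrow> 'r ^ 'm ^ 'p \<Rightarrow> 'r ^ 'p ^ 'p \<Rightarrow> bool" where
  "normalized_left_factorization star emb P N D \<longleftrightarrow>
     left_coprime_factorization P N D \<and>
     map_matrix emb N ** matrix_star star (map_matrix emb N) +
     map_matrix emb D ** matrix_star star (map_matrix emb D) = mat 1"

definition normalized_plants ::
    "('s::complex_comm_banach_algebra_1 \<Rightarrow> 's) \<Rightarrow> ('r::idom \<Rightarrow> 's) \<Rightarrow>
     ('r fract ^ 'm::finite ^ 'p::finite) set" where
  "normalized_plants star emb =
     {P. (\<exists>N D. normalized_right_factorization star emb P N D) \<and>
         (\<exists>N D. normalized_left_factorization star emb P N D)}"

section \<open>The nu-metric\<close>

text \<open>Block matrices are indexed by sum types: \<open>stack_matrix N D\<close> has \<open>N\<close> above \<open>D\<close>, and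
  \<open>beside_matrix A B\<close> has \<open>A\<close> to the left of \<open>B\<close>.\<close>

definition stack_matrix :: "'a ^ 'm::finite ^ 'p::finite \<Rightarrow> 'a ^ 'm ^ 'q::finite \<Rightarrow> 'a ^ 'm ^ ('p + 'q)" where
  "stack_matrix N D = (\<chi> i. case i of Inl k \<Rightarrow> N $ k | Inr k \<Rightarrow> D $ k)"

definition beside_matrix :: "'a ^ 'q::finite ^ 'p::finite \<Rightarrow> 'a ^ 'm::finite ^ 'p \<Rightarrow> 'a ^ ('q + 'm) ^ 'p" where
  "beside_matrix A B = (\<chi> i j. case j of Inl k \<Rightarrow> A $ i $ k | Inr k \<Rightarrow> B $ i $ k)"

definition right_symbol ::
    "('r \<Rightarrow> 's::complex_comm_banach_algebra_1) \<Rightarrow> 'r ^ 'm::finite ^ 'p::finite \<Rightarrow> 'r ^ 'm ^ 'm \<Rightarrow>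
     's ^ 'm ^ ('p + 'm)" where
  "right_symbol emb N D = stack_matrix (map_matrix emb N) (map_matrix emb D)"

definition left_symbol ::
    "('r \<Rightarrow> 's::complex_comm_banach_algebra_1) \<Rightarrow> 'r ^ 'm::finite ^ 'p::finite \<Rightarrow> 'r ^ 'p ^ 'p \<Rightarrow>
     's ^ ('p + 'm) ^ 'p" where
  "left_symbol emb N D = beside_matrix (- map_matrix emb D) (map_matrix emb N)"

text \<open>\<open>dnu_formula star \<iota> G\<^sub>1 G\<^sub>2 Gt\<^sub>2\<close>: the case distinction defining the metric, in terms of the
  symbols \<open>G\<^sub>1\<close>, \<open>G\<^sub>2\<close> of right factorizations and \<open>Gt\<^sub>2\<close> of a left factorization.\<close>

definition dnu_formula ::
    "('s::complex_comm_banach_algebra_1 \<Rightarrow> 's) \<Rightarrow> ('s \<Rightarrow> 'g::ab_group_add) \<Rightarrow>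
     's ^ 'm::finite ^ ('p::finite + 'm) \<Rightarrow> 's ^ 'm ^ ('p + 'm) \<Rightarrow> 's ^ ('p + 'm) ^ 'p \<Rightarrow> real" where
  "dnu_formula star \<iota> G\<^sub>1 G\<^sub>2 Gt\<^sub>2 =
     (if det (matrix_star star G\<^sub>1 ** G\<^sub>2) \<in> inv_elems \<and> \<iota> (det (matrix_star star G\<^sub>1 ** G\<^sub>2)) = 0
      then matrix_norm_inf (Gt\<^sub>2 ** G\<^sub>1) else 1)"

text \<open>\<open>r\<close> is a value of the metric at \<open>(P\<^sub>1, P\<^sub>2)\<close> for some choice of normalized factorizations.\<close>

definition dnu_value ::
    "('s::complex_comm_banach_algebra_1 \<Rightarrow> 's) \<Rightarrow> ('r::idom \<Rightarrow> 's) \<Rightarrow> ('s \<Rightarrow> 'g::ab_group_add) \<Rightarrow>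
     'r fract ^ 'm::finite ^ 'p::finite \<Rightarrow> 'r fract ^ 'm ^ 'p \<Rightarrow> real \<Rightarrow> bool" where
  "dnu_value star emb \<iota> P\<^sub>1 P\<^sub>2 r \<longleftrightarrow>
     (\<exists>N\<^sub>1 D\<^sub>1 N\<^sub>2 D\<^sub>2 Nt\<^sub>2 Dt\<^sub>2.
        normalized_right_factorization star emb P\<^sub>1 N\<^sub>1 D\<^sub>1 \<and>
        normalized_right_factorization star emb P\<^sub>2 N\<^sub>2 D\<^sub>2 \<and>
        normalized_left_factorization star emb P\<^sub>2 Nt\<^sub>2 Dt\<^sub>2 \<and>
        r = dnu_formula star \<iota> (right_symbol emb N\<^sub>1 D\<^sub>1) (right_symbol emb N\<^sub>2 D\<^sub>2)
              (left_symbol emb Nt\<^sub>2 Dt\<^sub>2))"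

text \<open>The value 0 outside the set is a convention, needed because \<open>Metric_space M d\<close> requires
  nonnegativity and symmetry of \<open>d\<close> on the whole type.\<close>

definition dnu ::
    "('s::complex_comm_banach_algebra_1 \<Rightarrow> 's) \<Rightarrow> ('r::idom \<Rightarrow> 's) \<Rightarrow> ('s \<Rightarrow> 'g::ab_group_add) \<Rightarrow>
     'r fract ^ 'm::finite ^ 'p::finite \<Rightarrow> 'r fract ^ 'm ^ 'p \<Rightarrow> real" where
  "dnu star emb \<iota> P\<^sub>1 P\<^sub>2 =
     (if P\<^sub>1 \<in> normalized_plants star emb \<and> P\<^sub>2 \<in> normalized_plants star emb
      then (THE r. dnu_value star emb \<iota> P\<^sub>1 P\<^sub>2 r) else 0)"

end

theory Submission
  imports Defs
begin

text \<open>Every maximal ideal of \<open>S\<close> is the kernel of a character (Gelfand-Mazur), so invertibility in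
  \<open>S\<close> and equality of matrices over \<open>S\<close> can be tested at characters. Let \<open>G\<close>, \<open>H\<close> be the right and the left
  symbol of a plant. At a character, normalization gives \<open>G G\<^sup>* + H\<^sup>* H = 1\<close>, whence \<open>\<parallel>H\<^sub>2 G\<^sub>1 x\<parallel>\<^sup>2 + \<parallel>G\<^sub>2\<^sup>* G\<^sub>1 x\<parallel>\<^sup>2 = \<parallel>x\<parallel>\<^sup>2\<close>; this yields symmetry and
  the triangle inequality for the norms. The index condition is transitive when
  \<open>a + b < 1\<close>, where \<open>a\<close>, \<open>b\<close> are the two distances, because
  \<open>G\<^sub>1\<^sup>* G\<^sub>3 = (G\<^sub>1\<^sup>* G\<^sub>2)(G\<^sub>2\<^sup>* G\<^sub>3) + (H\<^sub>2 G\<^sub>1)\<^sup>*(H\<^sub>2 G\<^sub>3)\<close> and, as \<open>a\<^sup>2 + b\<^sup>2 < 1\<close>, scaling the last summand by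
  \<open>t \<in> [0,1]\<close> keeps the determinant invertible, so that its index stays constant.\<close>

section \<open>Maximal ideals and characters\<close>

text \<open>Bridges HOL-Algebra, where ideals live in a ring record, and type-class arithmetic.
  Closure under negation, which an additive subgroup requires, comes from absorbing multiplication
  by -1.\<close>

lemma ideal_class_iff:
  "ideal (I :: 'a::comm_ring_1 set) cring_class_ops \<longleftrightarrow>
     0 \<in> I \<and> (\<forall>x\<in>I. \<forall>y\<in>I. x + y \<in> I) \<and> (\<forall>x\<in>I. \<forall>r. r * x \<in> I)" (is "_ \<longleftrightarrow> ?r")
proof
  assume "ideal I cring_class_ops"
  then interpret ideal I "cring_class_ops :: 'a ring" .
  show ?r
    using zero_closed a_closed I_l_closed by (auto simp: class_simps)
next
  assume r: ?r
  have neg: "- x \<in> I" if "x \<in> I" for x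
    using r that mult_minus1[of x] by metis
  have sub: "subgroup I (add_monoid (cring_class_ops :: 'a ring))"
  proof
    fix x :: 'a assume "x \<in> I"
    then show "inv\<^bsub>add_monoid cring_class_ops\<^esub> x \<in> I"
      using neg uminus_class[of x] unfolding a_inv_def by simp
  qed (use r in \<open>auto simp: cring_class_ops_def\<close>)
  show "ideal I cring_class_ops"
    using r by (intro idealI sub cring_class.ring_axioms) (auto simp: class_simps mult.commute)
qed

text \<open>Krull's theorem: Zorn's lemma is applied to the ideals that contain \<open>x\<close> but
  not 1. The principal ideal of \<open>x\<close> is one of them, and avoiding 1 survives unions of
  chains.\<close>

lemma nonunit_in_maximal_ideal:
  fixes x :: "'a::comm_ring_1"
  assumes "\<not> x dvd 1"
  obtains I where "maximalideal I cring_class_ops" "x \<in> I"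
proof -
  define A where "A = {J. ideal J (cring_class_ops :: 'a ring) \<and> x \<in> J \<and> 1 \<notin> J}"
  have "range ((*) x) \<in> A"
    unfolding A_def ideal_class_iff mem_Collect_eq
  proof (intro conjI ballI allI)
    show "0 \<in> range ((*) x)" by (metis mult_zero_right rangeI)
    show "x \<in> range ((*) x)" by (metis mult.right_neutral rangeI)
    show "1 \<notin> range ((*) x)" using assms by (auto simp: dvd_def)
    show "a + b \<in> range ((*) x)" if "a \<in> range ((*) x)" "b \<in> range ((*) x)" for a b
      using that by (auto simp flip: distrib_left)
    show "r * a \<in> range ((*) x)" if a: "a \<in> range ((*) x)" for a r
    proof -
      from a obtain b where "a = x * b" by blast
      then have "r * a = x * (r * b)" by (simp add: mult.left_commute)
      then show ?thesis by blast
    qed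
  qed
  then have ne: "A \<noteq> {}" by auto
  have "\<Union>C \<in> A" if "C \<noteq> {}" "subset.chain A C" for C
  proof -
    have CA: "C \<subseteq> A" and ch: "\<And>J K. J \<in> C \<Longrightarrow> K \<in> C \<Longrightarrow> J \<subseteq> K \<or> K \<subseteq> J"
      using that(2) unfolding subset.chain_def by blast+
    have id: "ideal J (cring_class_ops :: 'a ring)" "x \<in> J" "1 \<notin> J" if "J \<in> C" for J
      using CA that unfolding A_def by auto
    have "a + b \<in> \<Union>C" if ab: "a \<in> J" "b \<in> K" and JK: "J \<in> C" "K \<in> C" for a b J K
    proof -
      obtain L where "L \<in> C" "a \<in> L" "b \<in> L"
        using ch[OF JK] ab JK by blast
      then show ?thesis using id(1)[of L] unfolding ideal_class_iff by blast
    qed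
    moreover have "0 \<in> \<Union>C" "x \<in> \<Union>C" "1 \<notin> \<Union>C"
      using id that(1) unfolding ideal_class_iff by auto
    moreover have "r * a \<in> \<Union>C" if "a \<in> \<Union>C" for a r
      using id(1) that unfolding ideal_class_iff by blast
    ultimately show ?thesis
      unfolding A_def ideal_class_iff by (simp only: mem_Collect_eq) blast
  qed
  from subset_Zorn_nonempty[OF ne this] obtain M where
    M: "M \<in> A" "\<And>J. J \<in> A \<Longrightarrow> M \<subseteq> J \<Longrightarrow> J = M" by blast
  have "maximalideal M cring_class_ops"
  proof (rule maximalidealI)
    show "ideal M cring_class_ops" using M A_def by blast
    show "carrier cring_class_ops \<noteq> M"
      using M(1) unfolding A_def by (auto simp: cring_class_ops_def)
    fix J assume J: "ideal J (cring_class_ops :: 'a ring)" "M \<subseteq> J"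
    show "J = M \<or> J = carrier cring_class_ops"
    proof (cases "1 \<in> J")
      case True
      then have "r \<in> J" for r
        using J(1) unfolding ideal_class_iff by (metis mult.right_neutral)
      then show ?thesis by (auto simp: cring_class_ops_def)
    next
      case False
      then have "J \<in> A" using J M(1) unfolding A_def by blast
      then show ?thesis using M(2) J by blast
    qed
  qed
  then show ?thesis using M(1) that unfolding A_def by blast
qed

text \<open>A geometric sum whose ratio differs from 1 but has n-th power 1. Averaging over the
  roots of unity thereby removes every power except the zeroth.\<close>

lemma sum_power_roots_unity:
  assumes "0 < j" "j < n"
  shows "(\<Sum>k<n. exp (2 * of_real pi * \<i> * of_nat k / of_nat n) ^ j) = (0::complex)"
proof -
  define z where "z = exp (2 * of_real pi * \<i> * of_nat j / of_nat n)"
  have n: "n \<noteq> 0" using assms by simp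
  have "exp (2 * of_real pi * \<i> * of_nat k / of_nat n) ^ j = z ^ k" for k
    unfolding z_def by (simp flip: exp_of_nat_mult add: field_simps)
  moreover have "z \<noteq> 1"
    using assms complex_root_unity_eq_1[of n j] unfolding z_def
    by (auto dest: nat_dvd_not_less)
  moreover have "z ^ n = 1"
    unfolding z_def using complex_root_unity[OF n] .
  ultimately show ?thesis
    by (simp add: geometric_sum)
qed

section \<open>Scalars as elements \<open>scaleC c 1\<close> of the algebra\<close>

lemma scaleC_eq_mult: "scaleC c x = scaleC c 1 * (x :: 'a::complex_comm_banach_algebra_1)"
  by (simp add: mult_scaleC_left)

lemma scaleC_one_mult:
  "scaleC c 1 * scaleC d 1 = (scaleC (c * d) 1 :: 'a::complex_comm_banach_algebra_1)"
  by (simp add: mult_scaleC_left scaleC_scaleC)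

lemma scaleC_one [simp]: "scaleC 1 x = (x :: 'a::complex_comm_banach_algebra_1)"
  using scaleC_of_real[of 1 x] by simp

lemma scaleC_zero [simp]: "scaleC 0 x = (0 :: 'a::complex_comm_banach_algebra_1)"
  using scaleC_of_real[of 0 x] by simp

lemma scaleC_minus: "scaleC (- c) x = - scaleC c (x :: 'a::complex_comm_banach_algebra_1)"
  using scaleC_add_left[of "- c" c x] by (simp add: eq_neg_iff_add_eq_0)

lemma scaleC_diff_left:
  "scaleC (c - d) x = scaleC c x - scaleC d (x :: 'a::complex_comm_banach_algebra_1)"
  using scaleC_add_left[of c "- d" x] by (simp add: scaleC_minus)

lemma scaleC_power:
  "scaleC c 1 ^ n = (scaleC (c ^ n) 1 :: 'a::complex_comm_banach_algebra_1)"
  by (induction n) (simp_all add: scaleC_one_mult)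

lemma scaleC_sum_left:
  "scaleC (sum f A) x = (\<Sum>i\<in>A. scaleC (f i) (x :: 'a::complex_comm_banach_algebra_1))"
  by (induction A rule: infinite_finite_induct) (simp_all add: scaleC_add_left)

text \<open>The Neumann series of \<open>1 - x\<close> is the inverse of \<open>x\<close>.\<close>

lemma dvd_one_of_norm_less:
  fixes x :: "'a::{real_normed_algebra_1,comm_ring_1,banach}"
  assumes "norm (1 - x) < 1"
  shows "x dvd 1"
proof -
  let ?b = "1 - x"
  have s: "summable (\<lambda>n. ?b ^ n)"
    using assms by (rule complete_algebra_summable_geometric)
  have "(\<Sum>n. ?b ^ n) = 1 + (\<Sum>n. ?b ^ Suc n)"
    using suminf_split_head[OF s] by simp
  also have "(\<Sum>n. ?b ^ Suc n) = ?b * (\<Sum>n. ?b ^ n)"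
    using suminf_mult[OF s, of ?b] by simp
  finally have "x * (\<Sum>n. ?b ^ n) = 1"
    by (simp add: algebra_simps)
  then show ?thesis by (metis dvdI)
qed

section \<open>The quotient by a maximal ideal and the Gelfand-Mazur theorem\<close>

locale banach_maximal_ideal =
  fixes I :: "'s::complex_comm_banach_algebra_1 set"
  assumes maximal: "maximalideal I cring_class_ops"
begin

lemma ideal: "ideal I cring_class_ops"
  using maximal by (rule maximalideal.axioms)

lemma zero_mem: "0 \<in> I"
  and add_mem: "x \<in> I \<Longrightarrow> y \<in> I \<Longrightarrow> x + y \<in> I"
  and mult_mem: "x \<in> I \<Longrightarrow> r * x \<in> I"
  using ideal unfolding ideal_class_iff by auto

lemma mult_mem2: "x \<in> I \<Longrightarrow> x * r \<in> I"
  using mult_mem[of x r] by (simp add: mult.commute)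

lemma minus_mem: "x \<in> I \<Longrightarrow> - x \<in> I"
  using mult_mem[of x "-1"] by simp

lemma diff_mem: "x \<in> I \<Longrightarrow> y \<in> I \<Longrightarrow> x - y \<in> I"
  using add_mem[of x "-y"] minus_mem[of y] by simp

lemma sum_mem: "(\<And>i. i \<in> A \<Longrightarrow> f i \<in> I) \<Longrightarrow> sum f A \<in> I"
  by (induction A rule: infinite_finite_induct) (auto intro: zero_mem add_mem)

lemma one_notin: "1 \<notin> I"
proof
  assume "1 \<in> I"
  then have "r \<in> I" for r using mult_mem[of 1 r] by simp
  then have "I = UNIV" by blast
  then show False
    using maximal by (simp add: maximalideal_def maximalideal_axioms_def cring_class_ops_def)
qed

text \<open>The quotient by \<open>I\<close> is a field: by maximality the ideal generated by
  \<open>I\<close> and \<open>y\<close> is the whole ring, so it contains 1.\<close>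

lemma inverse_mod:
  assumes "y \<notin> I"
  obtains z where "y * z - 1 \<in> I"
proof -
  define J where "J = {i + r * y |i r. i \<in> I}"
  have J: "ideal J cring_class_ops"
    unfolding ideal_class_iff
  proof (intro conjI ballI allI)
    show "0 \<in> J"
      unfolding J_def mem_Collect_eq using zero_mem by (intro exI[of _ 0]) simp
    show "a + b \<in> J" if ab: "a \<in> J" "b \<in> J" for a b
    proof -
      from ab obtain i r j s where "i \<in> I" "j \<in> I" "a = i + r * y" "b = j + s * y"
        unfolding J_def by blast
      then have "a + b = (i + j) + (r + s) * y" "i + j \<in> I"
        by (auto simp: algebra_simps add_mem)
      then show ?thesis unfolding J_def by blast
    qed
    show "t * a \<in> J" if a: "a \<in> J" for a t
    proof -
      from a obtain i r where "i \<in> I" "a = i + r * y"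
        unfolding J_def by blast
      then have "t * a = t * i + (t * r) * y" "t * i \<in> I"
        by (simp_all add: distrib_left mult.assoc mult_mem)
      then show ?thesis unfolding J_def by blast
    qed
  qed
  have "y = 0 + 1 * y" by simp
  then have "y \<in> J" unfolding J_def using zero_mem by blast
  moreover have "I \<subseteq> J"
  proof
    fix i assume "i \<in> I"
    moreover have "i = i + 0 * y" by simp
    ultimately show "i \<in> J" unfolding J_def by blast
  qed
  ultimately have "J = UNIV"
    using maximalideal.I_maximal[OF maximal J] assms by (auto simp: cring_class_ops_def)
  then have "1 \<in> J" by simp
  then obtain i r where "i \<in> I" "1 = i + r * y"
    unfolding J_def by blast
  then have "y * r - 1 = - i" "i \<in> I" by (auto simp: algebra_simps)
  then show ?thesis using minus_mem that by metis
qed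

text \<open>The quotient seminorm of \<open>S/I\<close>; working with it avoids constructing the quotient algebra.\<close>

definition q :: "'s \<Rightarrow> real" where "q x = infdist x I"

lemma q_nonneg: "0 \<le> q x"
  unfolding q_def by (rule infdist_nonneg)

lemma q_le: "i \<in> I \<Longrightarrow> q x \<le> norm (x - i)"
  unfolding q_def using infdist_le[of i I x] by (simp add: dist_norm)

lemma q_approx: "e > 0 \<Longrightarrow> \<exists>i\<in>I. norm (x - i) < q x + e"
proof -
  assume e: "e > 0"
  have "\<exists>a\<in>dist x ` I. a < q x + e"
  proof (rule cInf_lessD)
    show "dist x ` I \<noteq> {}" using zero_mem by blast
    show "Inf (dist x ` I) < q x + e"
      using e zero_mem unfolding q_def infdist_def by auto
  qed
  then show ?thesis by (auto simp: dist_norm)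
qed

lemma q_le_norm: "q x \<le> norm x"
  using q_le[OF zero_mem, of x] by simp

lemma q_cong: "x - y \<in> I \<Longrightarrow> q x = q y"
proof -
  have *: "q x \<le> q y" if xy: "x - y \<in> I" for x y
  proof (rule field_le_epsilon)
    fix e :: real assume "e > 0"
    then obtain i where i: "i \<in> I" "norm (y - i) < q y + e" using q_approx by blast
    have "q x \<le> norm (x - (i + (x - y)))"
      by (rule q_le) (use i xy add_mem in blast)
    then show "q x \<le> q y + e" using i by (simp add: algebra_simps)
  qed
  assume "x - y \<in> I"
  moreover from minus_mem[OF this] have "y - x \<in> I" by simp
  ultimately show ?thesis using * by (meson antisym)
qed

lemma q_add: "q (x + y) \<le> q x + q y"
proof (rule field_le_epsilon)
  fix e :: real assume e: "e > 0"
  obtain i where i: "i \<in> I" "norm (x - i) < q x + e / 2" using q_approx[of "e/2"] e by force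
  obtain j where j: "j \<in> I" "norm (y - j) < q y + e / 2" using q_approx[of "e/2"] e by force
  have "q (x + y) \<le> norm ((x + y) - (i + j))"
    by (rule q_le) (use i j add_mem in blast)
  also have "\<dots> \<le> norm (x - i) + norm (y - j)"
    by (metis add_diff_add norm_triangle_ineq)
  finally show "q (x + y) \<le> q x + q y + e" using i j by linarith
qed

lemma q_mult: "q (x * y) \<le> q x * q y"
proof -
  have le: "q (x * y) \<le> (q x + e) * (q y + e)" if e: "e > 0" for e
  proof -
    obtain i where i: "i \<in> I" "norm (x - i) < q x + e" using q_approx e by blast
    obtain j where j: "j \<in> I" "norm (y - j) < q y + e" using q_approx e by blast
    \<comment> \<open>This element of \<open>I\<close> is chosen so that the difference factors as
      \<open>(x - i) * (y - j)\<close>.\<close>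
    have "q (x * y) \<le> norm (x * y - (i * y + (x - i) * j))"
      by (rule q_le) (use i j add_mem mult_mem mult_mem2 in blast)
    also have "x * y - (i * y + (x - i) * j) = (x - i) * (y - j)"
      by (simp add: algebra_simps)
    also have "norm \<dots> \<le> norm (x - i) * norm (y - j)" by (rule norm_mult_ineq)
    also have "\<dots> \<le> (q x + e) * (q y + e)"
      using i j q_nonneg[of x] e by (intro mult_mono) auto
    finally show ?thesis .
  qed
  have "((\<lambda>e. (q x + e) * (q y + e)) \<longlongrightarrow> (q x + 0) * (q y + 0)) (at_right 0)"
    by (intro tendsto_intros)
  moreover have "eventually (\<lambda>e. q (x * y) \<le> (q x + e) * (q y + e)) (at_right 0)"
    using le by (auto simp: eventually_at_right_less eventually_at_filter)
  ultimately show ?thesis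
    using tendsto_lowerbound[of _ _ "at_right (0::real)"] by fastforce
qed

text \<open>An element of \<open>I\<close> at distance less than 1 from 1 would be a unit by the
  Neumann series, and then 1 would lie in \<open>I\<close>.\<close>

lemma q_one: "q 1 = 1"
proof (rule antisym)
  show "q 1 \<le> 1" using q_le_norm[of 1] by simp
  show "1 \<le> q 1"
  proof (rule ccontr)
    assume "\<not> 1 \<le> q 1"
    then obtain i where i: "i \<in> I" "norm (1 - i) < 1"
      using q_approx[of "1 - q 1" 1] by auto
    then have "i dvd 1" by (intro dvd_one_of_norm_less)
    then obtain k where "1 = i * k" by (auto simp: dvd_def)
    then show False using mult_mem2[OF i(1), of k] one_notin by simp
  qed
qed

lemma q_scaleC: "q (scaleC c x) \<le> cmod c * q x"
proof -
  have "q (scaleC c x) \<le> q (scaleC c 1) * q x"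
    using q_mult[of "scaleC c 1" x] scaleC_eq_mult[of c x] by simp
  also have "\<dots> \<le> cmod c * q x"
    using q_le_norm[of "scaleC c 1"] by (intro mult_right_mono q_nonneg) (simp add: norm_scaleC)
  finally show ?thesis .
qed

lemma q_sum: "q (sum f A) \<le> (\<Sum>i\<in>A. q (f i))"
proof (induction A rule: infinite_finite_induct)
  case (insert a A)
  then show ?case using q_add[of "f a" "sum f A"] by simp
qed (use q_le_norm[of 0] in auto)

lemma q_minus: "q (- x) = q x"
proof -
  have "q (- x) \<le> q x" for x
    using q_scaleC[of "-1" x] by (simp add: scaleC_minus)
  from this[of x] this[of "- x"] show ?thesis by simp
qed


text \<open>Rickart's elementary proof of the Gelfand-Mazur theorem: averaging the resolvent of \<open>y\<close>
  over the \<open>n\<close>-th roots of unity gives the inverse of \<open>1 - r\<^sup>n y\<^sup>n\<close>, so uniform continuity of the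
  resolvent propagates \<open>r\<^sup>n y\<^sup>n \<longlonglongrightarrow> 0\<close> to all \<open>r\<close>, which contradicts the invertibility of \<open>y\<close>.\<close>

lemma gelfand_mazur_mod:
  obtains c where "y - scaleC c 1 \<in> I"
proof (rule ccontr)
  assume "\<not> thesis"
  with that have notin: "y - scaleC c 1 \<notin> I" for c by blast
  \<comment> \<open>Replacing \<open>y - c\<close> by \<open>1 - c * y\<close> makes the resolvent
    available at \<open>c = 0\<close>, where the radius will start.\<close>
  have "1 - scaleC c 1 * y \<notin> I" for c
  proof (cases "c = 0")
    case True
    then show ?thesis using one_notin by simp
  next
    case False
    have "y - scaleC (1 / c) 1 = scaleC (- (1 / c)) 1 * (1 - scaleC c 1 * y)"
      using False by (simp add: right_diff_distrib mult.assoc[symmetric] scaleC_one_mult scaleC_minus)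
    then show ?thesis using notin[of "1 / c"] mult_mem by metis
  qed
  then have "\<exists>z. (1 - scaleC c 1 * y) * z - 1 \<in> I" for c
    using inverse_mod by metis
  then obtain f where f: "\<And>c. (1 - scaleC c 1 * y) * f c - 1 \<in> I" by metis

  \<comment> \<open>The resolvent identity: modulo \<open>I\<close>, the difference
    \<open>f a - f b\<close> is \<open>(a - b) * y * f a * f b\<close>.\<close>
  have lip: "q (f a - f b) \<le> cmod (a - b) * (q y * q (f a) * q (f b))" for a b
  proof -
    have "f a - f b - scaleC (a - b) (y * f a * f b) =
        f b * ((1 - scaleC a 1 * y) * f a - 1) - f a * ((1 - scaleC b 1 * y) * f b - 1)"
      by (subst scaleC_eq_mult) (simp add: algebra_simps scaleC_diff_left)
    moreover have "\<dots> \<in> I" by (intro diff_mem mult_mem f)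
    ultimately have "q (f a - f b) = q (scaleC (a - b) (y * f a * f b))"
      using q_cong[of "f a - f b"] by simp
    also have "\<dots> \<le> cmod (a - b) * q (y * f a * f b)" by (rule q_scaleC)
    also have "\<dots> \<le> cmod (a - b) * (q y * q (f a) * q (f b))"
      by (intro mult_left_mono order_trans[OF q_mult] mult_right_mono q_mult q_nonneg) auto
    finally show ?thesis .
  qed
  have diff: "\<bar>q u - q v\<bar> \<le> q (u - v)" for u v
    using q_add[of "u - v" v] q_add[of "v - u" u] q_minus[of "u - v"] by simp
  \<comment> \<open>Near \<open>a\<close>, the bound \<open>lip\<close> has a factor below 1/2 in
    front of \<open>q (f b)\<close>. This gives \<open>q (f b) \<le> 2 * q (f a)\<close>, and
    \<open>lip\<close> then forces convergence.\<close>
  have cont: "isCont (\<lambda>c. q (f c)) a" for a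
  proof -
    have ev: "eventually (\<lambda>b. cmod (b - a) * (q y * q (f a)) < 1 / 2) (at a)"
    proof -
      have "((\<lambda>b. cmod (b - a) * (q y * q (f a))) \<longlongrightarrow> cmod (a - a) * (q y * q (f a))) (at a)"
        by (intro tendsto_intros)
      then show ?thesis using order_tendstoD(2)[of _ 0 "at a" "1 / 2 :: real"] by simp
    qed
    have "eventually (\<lambda>b. norm (q (f b) - q (f a)) \<le> cmod (b - a) * (2 * q y * (q (f a))\<^sup>2)) (at a)"
      using ev
    proof eventually_elim
      case (elim b)
      have 1: "\<bar>q (f b) - q (f a)\<bar> \<le> cmod (b - a) * (q y * q (f b) * q (f a))"
        using diff lip order_trans by blast
      also have "\<dots> = (cmod (b - a) * (q y * q (f a))) * q (f b)" by (simp add: ac_simps)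
      also have "\<dots> \<le> 1 / 2 * q (f b)"
        using elim q_nonneg by (intro mult_right_mono) auto
      finally have "q (f b) \<le> 2 * q (f a)" by linarith
      then have "cmod (b - a) * (q y * q (f b) * q (f a)) \<le>
          cmod (b - a) * (q y * (2 * q (f a)) * q (f a))"
        by (intro mult_left_mono mult_right_mono q_nonneg) auto
      with 1 show ?case by (simp add: power2_eq_square ac_simps)
    qed
    moreover have "((\<lambda>b. cmod (b - a) * (2 * q y * (q (f a))\<^sup>2)) \<longlongrightarrow>
        cmod (a - a) * (2 * q y * (q (f a))\<^sup>2)) (at a)"
      by (intro tendsto_intros)
    ultimately have "((\<lambda>b. q (f b) - q (f a)) \<longlongrightarrow> 0) (at a)"
      unfolding diff_self norm_zero mult_zero_left by (rule Lim_null_comparison)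
    then show ?thesis unfolding isCont_def by (simp add: LIM_zero_iff)
  qed

  have "y \<notin> I" using notin[of 0] by simp
  then obtain z where z: "y * z - 1 \<in> I" by (rule inverse_mod)
  \<comment> \<open>The contradiction will come at a radius between \<open>q z\<close> and
    \<open>q z + 1\<close>; the remaining 1 leaves room for a further step \<delta>.\<close>
  define R where "R = q z + 2"
  have R: "R > 0" unfolding R_def using q_nonneg[of z] by simp
  \<comment> \<open>Compactness of the disc bounds \<open>q (f c)\<close> uniformly, which turns
    \<open>lip\<close> into a Lipschitz estimate with one constant \<open>L\<close>.\<close>
  have "bounded ((\<lambda>c. q (f c)) ` cball 0 R)"
    by (intro compact_imp_bounded compact_continuous_image continuous_at_imp_continuous_on) (auto simp: cont)
  then obtain B where B: "B > 0" "\<And>c. c \<in> cball 0 R \<Longrightarrow> q (f c) \<le> B"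
    unfolding bounded_pos by (auto simp: abs_le_iff)
  define L where "L = q y * B * B"
  have L0: "0 \<le> L" unfolding L_def using B q_nonneg by simp
  have lipL: "q (f a - f b) \<le> L * cmod (a - b)" if "cmod a \<le> R" "cmod b \<le> R" for a b
  proof -
    have "q (f a - f b) \<le> cmod (a - b) * (q y * q (f a) * q (f b))" by (rule lip)
    also have "\<dots> \<le> cmod (a - b) * (q y * B * B)"
      using that B by (intro mult_left_mono mult_mono q_nonneg) (auto simp: q_nonneg)
    finally show ?thesis by (simp add: L_def ac_simps)
  qed

  define w where "w n k = exp (2 * of_real pi * \<i> * of_nat k / of_nat n)" for n k :: nat
  have norm_w: "cmod (w n k) = 1" for n k unfolding w_def by simp
  define g where "g n r = scaleC (1 / of_nat n) 1 * (\<Sum>k<n. f (of_real r * w n k))" for n :: nat and r :: real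
  \<comment> \<open>All \<open>?x k\<close> have the same n-th power, so \<open>?t\<close> times the
    resolvent at the k-th point is the geometric sum of \<open>?x k\<close> modulo \<open>I\<close>.
    Summing over \<open>k\<close> leaves only the terms with \<open>j = 0\<close>, whose total is
    \<open>n\<close>.\<close>
  have g_inv: "(1 - scaleC (of_real r ^ n) (y ^ n)) * g n r - 1 \<in> I" if n: "n > 0" for n r
  proof -
    let ?x = "\<lambda>k. scaleC (of_real r * w n k) 1 * y"
    let ?t = "1 - scaleC (of_real r ^ n) (y ^ n)"
    have xn: "?x k ^ n = scaleC (of_real r ^ n) (y ^ n)" for k
      using complex_root_unity[of n k] n scaleC_eq_mult[of "of_real r ^ n" "y ^ n"]
      by (simp add: power_mult_distrib scaleC_power w_def)
    have "?t * f (of_real r * w n k) - (\<Sum>j<n. ?x k ^ j) \<in> I" for k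
    proof -
      have "?t = (1 - ?x k) * (\<Sum>j<n. ?x k ^ j)"
        using one_diff_power_eq[of "?x k" n] xn[of k] by simp
      then have "?t * f (of_real r * w n k) - (\<Sum>j<n. ?x k ^ j) =
          (\<Sum>j<n. ?x k ^ j) * ((1 - ?x k) * f (of_real r * w n k) - 1)"
        by (simp only: right_diff_distrib mult_1_right) (simp only: ac_simps)
      then show ?thesis using mult_mem f by simp
    qed
    then have "(\<Sum>k<n. ?t * f (of_real r * w n k) - (\<Sum>j<n. ?x k ^ j)) \<in> I"
      by (intro sum_mem)
    moreover have "(\<Sum>k<n. \<Sum>j<n. ?x k ^ j) = scaleC (of_nat n) 1"
    proof -
      have "(\<Sum>k<n. \<Sum>j<n. ?x k ^ j) = (\<Sum>j<n. \<Sum>k<n. ?x k ^ j)" by (rule sum.swap)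
      also have "\<dots> = (\<Sum>j<n. if j = 0 then scaleC (of_nat n) 1 else 0)"
      proof (rule sum.cong[OF refl])
        fix j assume j: "j \<in> {..<n}"
        have "(\<Sum>k<n. ?x k ^ j) = scaleC (\<Sum>k<n. (of_real r * w n k) ^ j) 1 * y ^ j"
          by (simp add: power_mult_distrib scaleC_power scaleC_sum_left sum_distrib_right)
        also have "(\<Sum>k<n. (of_real r * w n k) ^ j) = of_real r ^ j * (\<Sum>k<n. w n k ^ j)"
          by (simp add: power_mult_distrib sum_distrib_left)
        finally have "(\<Sum>k<n. ?x k ^ j) = scaleC (of_real r ^ j * (\<Sum>k<n. w n k ^ j)) 1 * y ^ j" .
        then show "(\<Sum>k<n. ?x k ^ j) = (if j = 0 then scaleC (of_nat n) 1 else 0)"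
          using j sum_power_roots_unity[of j n] by (auto simp: w_def)
      qed
      also have "\<dots> = scaleC (of_nat n) 1" using n by simp
      finally show ?thesis .
    qed
    ultimately have "?t * (\<Sum>k<n. f (of_real r * w n k)) - scaleC (of_nat n) 1 \<in> I"
      by (simp add: sum_subtractf sum_distrib_left)
    from mult_mem[OF this, of "scaleC (1 / of_nat n) 1"] show ?thesis
      using n by (simp add: g_def right_diff_distrib scaleC_one_mult mult.left_commute)
  qed
  have g_lip: "q (g n r - g n s) \<le> L * \<bar>r - s\<bar>"
    if "n > 0" "0 \<le> r" "r \<le> R" "0 \<le> s" "s \<le> R" for n r s
  proof -
    have "g n r - g n s = scaleC (1 / of_nat n) (\<Sum>k<n. f (of_real r * w n k) - f (of_real s * w n k))"
      unfolding g_def sum_subtractf right_diff_distrib[symmetric] by (rule scaleC_eq_mult[symmetric])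
    then have "q (g n r - g n s) \<le> cmod (1 / of_nat n) * q (\<Sum>k<n. f (of_real r * w n k) - f (of_real s * w n k))"
      by (simp only: q_scaleC)
    also have "\<dots> \<le> (1 / real n) * (\<Sum>k<n. L * \<bar>r - s\<bar>)"
    proof (intro mult_mono order_trans[OF q_sum] sum_mono q_nonneg)
      fix k
      have "q (f (of_real r * w n k) - f (of_real s * w n k)) \<le>
          L * cmod (of_real r * w n k - of_real s * w n k)"
        by (rule lipL) (use that in \<open>auto simp: norm_mult norm_w\<close>)
      also have "of_real r * w n k - of_real s * w n k = of_real (r - s) * w n k"
        by (simp add: algebra_simps)
      finally show "q (f (of_real r * w n k) - f (of_real s * w n k)) \<le> L * \<bar>r - s\<bar>"
        by (simp only: norm_mult norm_w norm_of_real mult_1_right)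
    qed (auto simp: norm_divide)
    also have "\<dots> = L * \<bar>r - s\<bar>" using that by simp
    finally show ?thesis .
  qed

  \<comment> \<open>Moving the radius by \<delta> changes \<open>g\<close> by at most
    \<open>L * \<delta> \<le> 1 / 8\<close>; the summand 1 in \<open>L + 1\<close> prevents division
    by zero.\<close>
  define \<delta> where "\<delta> = 1 / (8 * (L + 1))"
  have \<delta>: "\<delta> > 0" "L * \<delta> \<le> 1 / 8" "\<delta> \<le> 1 / 8"
    using L0 by (auto simp: \<delta>_def field_simps)
  have q_pow: "q (scaleC (of_real r ^ n) (y ^ n)) \<le> r ^ n * q (y ^ n)"
    if "r \<ge> 0" for r n
    using q_scaleC[of "of_real r ^ n" "y ^ n"] that by (simp add: norm_power)
  have q_pow_ge: "r ^ n * q (y ^ n) \<le> q (scaleC (of_real r ^ n) (y ^ n))"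
    if r: "r > 0" for r n
  proof -
    have "q (y ^ n) = q (scaleC ((1 / of_real r) ^ n) (scaleC (of_real r ^ n) (y ^ n)))"
      using r by (simp add: scaleC_scaleC flip: power_mult_distrib)
    also have "\<dots> \<le> (1 / r) ^ n * q (scaleC (of_real r ^ n) (y ^ n))"
      using q_scaleC[of "(1 / of_real r) ^ n" "scaleC (of_real r ^ n) (y ^ n)"] r
      by (simp add: norm_power norm_divide)
    finally show ?thesis using r by (simp add: field_simps)
  qed

  \<comment> \<open>A move of the radius by \<delta> yields only boundedness of
    \<open>s ^ n * q (y ^ n)\<close>. Giving back half of it yields a factor \<open>p ^ n\<close>
    with \<open>p < 1\<close>, and so convergence to 0 again.\<close>
  have step: "(\<lambda>n. (r + \<delta> / 2) ^ n * q (y ^ n)) \<longlonglongrightarrow> 0"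
    if r: "(\<lambda>n. r ^ n * q (y ^ n)) \<longlonglongrightarrow> 0" "r \<ge> 0" "r + \<delta> \<le> R" for r
  proof -
    define s where "s = r + \<delta>"
    have s: "s > 0" "s \<le> R" "r \<le> R" "\<bar>s - r\<bar> = \<delta>" using r \<delta> by (auto simp: s_def)
    \<comment> \<open>With 1/4 here, \<open>q (g n r - 1)\<close> is at most 1/3. Adding 1/8 for the
      change of radius stays below 1/2, and from \<open>q ?c \<le> (1 + q ?c) / 2\<close> follows
      \<open>q ?c \<le> 1\<close>.\<close>
    have "eventually (\<lambda>n. r ^ n * q (y ^ n) < 1 / 4) sequentially"
      using r(1) by (rule order_tendstoD) simp
    then have bd: "eventually (\<lambda>n. s ^ n * q (y ^ n) \<le> 1) sequentially"
      using eventually_gt_at_top[of 0]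
    proof eventually_elim
      case (elim n)
      let ?b = "scaleC (of_real r ^ n) (y ^ n)" and ?c = "scaleC (of_real s ^ n) (y ^ n)"
      have b: "q ?b \<le> 1 / 4" using q_pow[of r n] r elim by linarith
      have "(g n r - 1) - ?b * g n r \<in> I"
        using g_inv[of n r] elim by (simp add: algebra_simps)
      then have "q (g n r - 1) = q (?b * g n r)" by (rule q_cong)
      also have "\<dots> \<le> q ?b * q (g n r)" by (rule q_mult)
      also have "\<dots> \<le> 1 / 4 * q (g n r)" using b q_nonneg by (intro mult_right_mono) auto
      also have "q (g n r) \<le> q (g n r - 1) + 1"
        using q_add[of "g n r - 1" 1] q_one by simp
      finally have "q (g n r - 1) \<le> 1 / 3" by simp
      moreover have "q (g n s - g n r) \<le> 1 / 8"
        using g_lip[of n s r] s r elim \<delta> by simp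
      ultimately have h: "q (g n s - 1) \<le> 1 / 2"
        using q_add[of "g n s - g n r" "g n r - 1"] by simp
      have "?c - (g n s - 1) * (1 - ?c) = - ((1 - ?c) * g n s - 1)"
        by (simp add: algebra_simps)
      then have "?c - (g n s - 1) * (1 - ?c) \<in> I"
        using minus_mem[OF g_inv[of n s]] elim by (simp only:)
      then have "q ?c = q ((g n s - 1) * (1 - ?c))" by (rule q_cong)
      also have "\<dots> \<le> q (g n s - 1) * q (1 - ?c)" by (rule q_mult)
      also have "\<dots> \<le> 1 / 2 * q (1 - ?c)" using h q_nonneg by (intro mult_right_mono) auto
      also have "q (1 - ?c) \<le> 1 + q ?c"
        using q_add[of 1 "- ?c"] q_one q_minus[of ?c] by simp
      finally have "q ?c \<le> 1" by simp
      then show ?case using q_pow_ge[of s n] s by linarith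
    qed
    define p where "p = (r + \<delta> / 2) / s"
    have p: "0 \<le> p" "p < 1" using r \<delta> s by (auto simp: p_def s_def field_simps)
    have "(\<lambda>n. p ^ n) \<longlonglongrightarrow> 0" using p by (intro LIMSEQ_realpow_zero)
    moreover have "eventually (\<lambda>n. norm ((r + \<delta> / 2) ^ n * q (y ^ n)) \<le> p ^ n) sequentially"
      using bd
    proof eventually_elim
      case (elim n)
      have "(r + \<delta> / 2) ^ n * q (y ^ n) = p ^ n * (s ^ n * q (y ^ n))"
        using s by (simp add: p_def power_divide)
      also have "\<dots> \<le> p ^ n * 1" using elim p by (intro mult_left_mono) auto
      finally show ?case using r \<delta> q_nonneg by simp
    qed
    ultimately show ?thesis by (rule Lim_null_comparison[rotated])
  qed

  have lim: "real k * (\<delta> / 2) \<le> q z + 1 \<Longrightarrow> (\<lambda>n. (real k * (\<delta> / 2)) ^ n * q (y ^ n)) \<longlonglongrightarrow> 0" for k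
  proof (induction k)
    case 0
    \<comment> \<open>The term for \<open>n = 0\<close> is not 0, since
      \<open>0 ^ 0 = 1\<close>.\<close>
    have "eventually (\<lambda>n. (0::real) ^ n * q (y ^ n) = 0) sequentially"
      using eventually_gt_at_top[of 0] by eventually_elim simp
    then show ?case by (simp add: tendsto_eventually)
  next
    case (Suc k)
    have *: "real (Suc k) * (\<delta> / 2) = real k * (\<delta> / 2) + \<delta> / 2" by (simp add: algebra_simps)
    show ?case
      unfolding * using Suc \<delta> * by (intro step) (auto simp: R_def)
  qed
  \<comment> \<open>Enough steps of length \<open>\<delta> / 2\<close> to reach \<open>q z\<close>,
    overshooting by at most one step.\<close>
  define k where "k = nat \<lceil>q z / (\<delta> / 2)\<rceil>"
  have k: "q z / (\<delta> / 2) \<le> real k" "real k \<le> q z / (\<delta> / 2) + 1"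
    using q_nonneg[of z] \<delta> unfolding k_def by (auto simp: le_of_int_ceiling)
  then have k: "q z \<le> real k * (\<delta> / 2)" "real k * (\<delta> / 2) \<le> q z + 1"
    using \<delta> by (auto simp: field_simps)
  have pow: "(y * z) ^ n - 1 \<in> I" for n
  proof (induction n)
    case (Suc n)
    have "(y * z) ^ Suc n - 1 = (y * z) * ((y * z) ^ n - 1) + (y * z - 1)"
      by (simp add: algebra_simps)
    then show ?case using add_mem[OF mult_mem[OF Suc] z] by (simp only:)
  qed (simp add: zero_mem)
  have q_power: "q (x ^ n) \<le> q x ^ n" for x n
  proof (induction n)
    case (Suc n)
    have "q (x ^ Suc n) \<le> q x * q (x ^ n)" using q_mult[of x "x ^ n"] by simp
    also have "\<dots> \<le> q x * q x ^ n" using Suc q_nonneg by (intro mult_left_mono) auto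
    finally show ?case by simp
  qed (simp add: q_one)
  \<comment> \<open>Modulo \<open>I\<close> the product \<open>y ^ n * z ^ n\<close> is 1, while
    \<open>q (z ^ n)\<close> is at most the n-th power of the radius reached. This contradicts the
    limit 0 there.\<close>
  have "1 \<le> (real k * (\<delta> / 2)) ^ n * q (y ^ n)" for n
  proof -
    have "1 = q ((y * z) ^ n)" using q_cong[OF pow, of n] q_one by simp
    also have "\<dots> \<le> q (y ^ n) * q (z ^ n)" using q_mult[of "y ^ n" "z ^ n"] by (simp add: power_mult_distrib)
    also have "\<dots> \<le> q (y ^ n) * (real k * (\<delta> / 2)) ^ n"
      using q_power[of z n] power_mono[OF k(1) q_nonneg, of n] q_nonneg
      by (intro mult_left_mono) auto
    finally show ?thesis by (simp add: mult.commute)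
  qed
  then have "1 \<le> (0::real)"
    using tendsto_lowerbound[OF lim[OF k(2)], of 1] by simp
  then show False by simp
qed

text \<open>By Gelfand-Mazur each \<open>x\<close> is congruent modulo \<open>I\<close> to a scalar.
  The scalar is unique, because nonzero scalars are units and \<open>I\<close> is proper, and
  uniqueness makes the assignment respect all operations.\<close>

lemma character_exists:
  obtains \<phi> where "\<phi> \<in> max_ideal_space" "\<And>x. \<phi> x = 0 \<longleftrightarrow> x \<in> I"
proof -
  have "\<exists>c. x - scaleC c 1 \<in> I" for x using gelfand_mazur_mod by metis
  then obtain \<phi> where \<phi>: "\<And>x. x - scaleC (\<phi> x) 1 \<in> I" by metis
  have uniq: "c = \<phi> x" if "x - scaleC c 1 \<in> I" for c x
  proof (rule ccontr)
    assume ne: "c \<noteq> \<phi> x"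
    have "scaleC (c - \<phi> x) 1 \<in> I"
      using diff_mem[OF \<phi>[of x] that] by (simp add: scaleC_diff_left)
    from mult_mem[OF this, of "scaleC (1 / (c - \<phi> x)) 1"] show False
      using ne one_notin by (simp add: scaleC_one_mult)
  qed
  have "\<phi> (x + y) = \<phi> x + \<phi> y" for x y
    using add_mem[OF \<phi>[of x] \<phi>[of y]]
    by (intro uniq[symmetric]) (simp add: scaleC_add_left algebra_simps)
  moreover have "\<phi> (scaleC c x) = c * \<phi> x" for c x
    using mult_mem[OF \<phi>[of x], of "scaleC c 1"] scaleC_eq_mult[of c x]
    by (intro uniq[symmetric]) (simp add: right_diff_distrib scaleC_one_mult)
  moreover have "\<phi> (x * y) = \<phi> x * \<phi> y" for x y
  proof (intro uniq[symmetric])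
    have "x * y - scaleC (\<phi> x * \<phi> y) 1 =
        (x - scaleC (\<phi> x) 1) * y + scaleC (\<phi> x) 1 * (y - scaleC (\<phi> y) 1)"
      by (simp add: algebra_simps scaleC_one_mult)
    then show "x * y - scaleC (\<phi> x * \<phi> y) 1 \<in> I"
      using add_mem[OF mult_mem2[OF \<phi>] mult_mem[OF \<phi>]] by simp
  qed
  moreover have "\<phi> 1 = 1"
    by (intro uniq[symmetric]) (simp add: zero_mem)
  ultimately have "\<phi> \<in> max_ideal_space"
    unfolding max_ideal_space_def by (auto intro: exI[of _ 1])
  moreover have "\<phi> x = 0 \<longleftrightarrow> x \<in> I" for x
    using \<phi>[of x] uniq[of x 0] by auto
  ultimately show ?thesis using that by blast
qed

end

section \<open>Invertibility and vanishing tested at characters\<close>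

lemma invertible_if_characters_nonzero:
  fixes x :: "'s::complex_comm_banach_algebra_1"
  assumes "\<And>\<phi>. \<phi> \<in> max_ideal_space \<Longrightarrow> \<phi> x \<noteq> 0"
  shows "x \<in> inv_elems"
proof (rule ccontr)
  assume "x \<notin> inv_elems"
  then have "\<not> x dvd 1" by (simp add: inv_elems_def)
  then obtain I where I: "maximalideal I cring_class_ops" "x \<in> I"
    by (rule nonunit_in_maximal_ideal)
  interpret banach_maximal_ideal I by (rule banach_maximal_ideal.intro) (rule I)
  show False using character_exists I(2) assms by metis
qed

text \<open>Ensures that the supremum in \<open>matrix_norm_inf\<close> is taken over a nonempty
  set.\<close>

lemma max_ideal_space_nonempty:
  "(max_ideal_space :: ('s::complex_comm_banach_algebra_1 \<Rightarrow> complex) set) \<noteq> {}"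
proof -
  have "\<not> (0::'s) dvd 1" by simp
  then obtain I where I: "maximalideal I (cring_class_ops :: 's ring)"
    by (rule nonunit_in_maximal_ideal)
  interpret banach_maximal_ideal I by (rule banach_maximal_ideal.intro) (rule I)
  obtain \<phi> where "\<phi> \<in> (max_ideal_space :: ('s \<Rightarrow> complex) set)" by (rule character_exists)
  then show ?thesis by blast
qed

lemma semisimple_eq_zero:
  fixes x :: "'s::complex_comm_banach_algebra_1"
  assumes "semisimple_algebra TYPE('s)"
    and "\<And>\<phi>. \<phi> \<in> max_ideal_space \<Longrightarrow> \<phi> x = 0"
  shows "x = 0"
proof -
  have "x \<in> I" if I: "maximalideal I cring_class_ops" for I
  proof -
    interpret banach_maximal_ideal I by (rule banach_maximal_ideal.intro) (rule I)
    show ?thesis using character_exists assms(2) by metis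
  qed
  then show ?thesis using assms(1) unfolding semisimple_algebra_def by blast
qed

section \<open>Matrices\<close>

text \<open>One interface for characters, the two embeddings of \<open>R\<close> (into
  \<open>S\<close> and into its fractions), the involution and complex conjugation.\<close>

locale unital_ring_hom =
  fixes f :: "'a::comm_ring_1 \<Rightarrow> 'b::comm_ring_1"
  assumes hom_add: "f (x + y) = f x + f y"
    and hom_mult: "f (x * y) = f x * f y"
    and hom_one: "f 1 = 1"
begin

lemma hom_zero: "f 0 = 0"
  using hom_add[of 0 0] by simp

lemma hom_minus: "f (- x) = - f x"
  using hom_add[of "- x" x] by (simp add: hom_zero eq_neg_iff_add_eq_0)

lemma hom_sum: "f (sum g X) = (\<Sum>i\<in>X. f (g i))"
  by (induction X rule: infinite_finite_induct) (simp_all add: hom_zero hom_add)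

lemma hom_prod: "f (prod g X) = (\<Prod>i\<in>X. f (g i))"
  by (induction X rule: infinite_finite_induct) (simp_all add: hom_one hom_mult)

lemma map_matrix_add: "map_matrix f (A + B) = map_matrix f A + map_matrix f B"
  by (simp add: vec_eq_iff hom_add)

lemma map_matrix_mult: "map_matrix f (A ** B) = map_matrix f A ** map_matrix f B"
  by (simp add: vec_eq_iff matrix_matrix_mult_def hom_sum hom_mult)

lemma map_matrix_zero: "map_matrix f 0 = 0"
  by (simp add: vec_eq_iff hom_zero)

lemma map_matrix_one: "map_matrix f (mat 1) = mat 1"
  by (simp add: vec_eq_iff mat_def hom_zero hom_one)

lemma map_matrix_det:
  fixes A :: "'a ^ 'n::finite ^ 'n"
  shows "f (det A) = det (map_matrix f A)"
proof -
  have "f (of_int (sign p)) = of_int (sign p)" for p :: "'n \<Rightarrow> 'n"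
    by (simp add: sign_def hom_one hom_minus)
  then show ?thesis
    by (simp add: det_def hom_sum hom_prod hom_mult)
qed

lemma map_matrix_unit: "x \<in> inv_elems \<Longrightarrow> f x \<in> inv_elems"
  unfolding inv_elems_def by (metis dvd_def hom_mult hom_one mem_Collect_eq)

end

lemma map_matrix_inj: "inj f \<Longrightarrow> map_matrix f A = map_matrix f B \<longleftrightarrow> A = B"
  by (simp add: vec_eq_iff inj_eq)

section \<open>Block matrices\<close>

lemma beside_mult_stack:
  fixes A :: "'a::semiring_1 ^ 'q::finite ^ 'k::finite"
  shows "beside_matrix A B ** stack_matrix C D = A ** C + B ** D"
  by (simp add: vec_eq_iff matrix_matrix_mult_def beside_matrix_def stack_matrix_def
      UNIV_Plus_UNIV[symmetric] sum.Plus del: UNIV_Plus_UNIV)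

lemma stack_mult: "stack_matrix A B ** C = stack_matrix (A ** C) (B ** C)"
  by (simp add: vec_eq_iff matrix_matrix_mult_def stack_matrix_def split: sum.split)

lemma stack_mult_beside:
  "stack_matrix A B ** beside_matrix C D =
     stack_matrix (beside_matrix (A ** C) (A ** D)) (beside_matrix (B ** C) (B ** D))"
  by (simp add: vec_eq_iff matrix_matrix_mult_def stack_matrix_def beside_matrix_def split: sum.split)

lemma mat_one_blocks:
  "stack_matrix (beside_matrix (mat 1) 0) (beside_matrix 0 (mat 1)) = mat 1"
  by (simp add: vec_eq_iff mat_def stack_matrix_def beside_matrix_def split: sum.split)

lemma matrix_star_nth [simp]: "matrix_star f A $ i $ j = f (A $ j $ i)"
  by (simp add: matrix_star_def)

lemma matrix_star_stack:
  "matrix_star f (stack_matrix A B) = beside_matrix (matrix_star f A) (matrix_star f B)"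
  by (simp add: vec_eq_iff stack_matrix_def beside_matrix_def split: sum.split)

lemma matrix_star_beside:
  "matrix_star f (beside_matrix A B) = stack_matrix (matrix_star f A) (matrix_star f B)"
  by (simp add: vec_eq_iff stack_matrix_def beside_matrix_def split: sum.split)

text \<open>In a commutative ring the reversal of products is invisible, so an additive involution
  of this kind is a ring homomorphism. The locale covers both the involution of \<open>S\<close> and
  \<open>cnj\<close>.\<close>

locale star_ring = unital_ring_hom f for f :: "'a::comm_ring_1 \<Rightarrow> 'a" +
  assumes star_star: "f (f x) = x"
begin

lemma matrix_star_mult: "matrix_star f (A ** B) = matrix_star f B ** matrix_star f A"
  by (simp add: vec_eq_iff matrix_matrix_mult_def hom_sum hom_mult mult.commute)

lemma matrix_star_star: "matrix_star f (matrix_star f A) = A"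
  by (simp add: vec_eq_iff star_star)

lemma matrix_star_one: "matrix_star f (mat 1) = mat 1"
  by (simp add: vec_eq_iff mat_def hom_zero hom_one)

lemma det_matrix_star: "det (matrix_star f A) = f (det A)"
proof -
  have "matrix_star f A = transpose (map_matrix f A)"
    by (simp add: vec_eq_iff transpose_def)
  then show ?thesis by (simp add: map_matrix_det)
qed

end

interpretation cnj: star_ring cnj
  by unfold_locales auto

abbreviation adj :: "complex ^ 'n::finite ^ 'k::finite \<Rightarrow> complex ^ 'k ^ 'n"
  where "adj \<equiv> matrix_star cnj"

lemma scaleR_matrix_vector_mult:
  "(t *\<^sub>R A) *v x = t *\<^sub>R (A *v (x :: 'a::real_normed_algebra_1 ^ 'n::finite))"
  by (simp add: vec_eq_iff matrix_vector_mult_def scaleR_sum_right)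

text \<open>Here \<open>inner\<close> is the real part of the Hermitian product; it still moves a
  matrix to its conjugate transpose.\<close>

lemma inner_matrix_vector_mult: "inner x (A *v y) = inner (adj A *v x) y"
proof -
  have "inner x (A *v y) = (\<Sum>i\<in>UNIV. \<Sum>j\<in>UNIV. inner (x $ i) (A $ i $ j * y $ j))"
    by (simp add: inner_vec_def matrix_vector_mult_def inner_sum_right)
  also have "\<dots> = (\<Sum>j\<in>UNIV. \<Sum>i\<in>UNIV. inner (x $ i) (A $ i $ j * y $ j))"
    by (rule sum.swap)
  also have "\<dots> = (\<Sum>j\<in>UNIV. \<Sum>i\<in>UNIV. inner (cnj (A $ i $ j) * x $ i) (y $ j))"
    by (intro sum.cong refl) (simp add: inner_complex_def algebra_simps)
  also have "\<dots> = inner (adj A *v x) y"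
    by (simp add: inner_vec_def matrix_vector_mult_def inner_sum_left)
  finally show ?thesis .
qed

lemma norm_matrix_vector_square: "(norm (A *v x))\<^sup>2 = inner x ((adj A ** A) *v x)"
proof -
  have "inner x (adj A *v (A *v x)) = inner (A *v x) (A *v x)"
    by (simp only: inner_matrix_vector_mult[of x "adj A"] cnj.matrix_star_star)
  then show ?thesis by (simp only: power2_norm_eq_inner matrix_vector_mul_assoc)
qed

lemma norm_isometry: "adj A ** A = mat 1 \<Longrightarrow> norm (A *v x) = norm x"
  using norm_matrix_vector_square[of A x] by (simp add: power2_norm_eq_inner norm_eq_sqrt_inner)

text \<open>Cauchy-Schwarz bounds the squared norm of \<open>adj A *v x\<close>, rewritten as an
  inner product of \<open>x\<close> with \<open>A *v (adj A *v x)\<close>; then one factor is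
  cancelled.\<close>

lemma norm_adj_le:
  assumes "\<And>x. norm (A *v x) \<le> a * norm x"
  shows "norm (adj A *v x) \<le> a * norm x"
proof (cases "adj A *v x = 0")
  case True
  \<comment> \<open>Read off at a unit vector.\<close>
  have "0 \<le> a"
    using order_trans[OF norm_ge_zero assms[of "axis undefined 1"]] by simp
  then show ?thesis using True by simp
next
  case False
  let ?w = "adj A *v x"
  have "norm ?w * norm ?w = inner ?w ?w"
    by (simp add: power2_norm_eq_inner flip: power2_eq_square)
  also have "\<dots> = inner x (A *v ?w)" by (simp add: inner_matrix_vector_mult)
  also have "\<dots> \<le> norm x * norm (A *v ?w)" by (rule norm_cauchy_schwarz)
  also have "\<dots> \<le> norm x * (a * norm ?w)" by (intro mult_left_mono assms) auto
  finally show ?thesis using False by (simp add: ac_simps)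
qed

text \<open>A square matrix that is bounded below is injective, hence invertible. Its inverse has
  norm at most \<open>1 / c\<close>, and so has the adjoint of the inverse.\<close>

lemma norm_adj_ge:
  fixes K :: "complex ^ 'n::finite ^ 'n"
  assumes "0 < c" "\<And>x. c * norm x \<le> norm (K *v x)"
  shows "c * norm x \<le> norm (adj K *v x)"
proof -
  have "x = 0" if "K *v x = 0" for x
    using assms(2)[of x] that assms(1) by (simp add: mult_le_0_iff)
  then obtain B where BK: "B ** K = mat 1"
    using matrix_left_invertible_ker[of K] by blast
  then have KB: "K ** B = mat 1" using matrix_left_right_inverse by blast
  have "norm (B *v y) \<le> (1 / c) * norm y" for y
    using assms(2)[of "B *v y"] assms(1) KB
    by (simp add: matrix_vector_mul_assoc field_simps)
  then have "norm (adj B *v (adj K *v x)) \<le> (1 / c) * norm (adj K *v x)"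
    by (rule norm_adj_le)
  moreover have "adj B ** adj K = mat 1"
    using KB by (simp add: cnj.matrix_star_one flip: cnj.matrix_star_mult)
  ultimately show ?thesis
    using assms(1) by (simp add: matrix_vector_mul_assoc field_simps)
qed

section \<open>Normalized pairs of complex matrices\<close>

text \<open>\<open>G\<close> and \<open>H\<close> stand for the values at a character of the right and the left symbol of one plant.\<close>

definition normalized_pair ::
    "complex ^ 'm::finite ^ ('p::finite + 'm) \<Rightarrow> complex ^ ('p + 'm) ^ 'p \<Rightarrow> bool" where
  "normalized_pair G H \<longleftrightarrow> adj G ** G = mat 1 \<and> H ** adj H = mat 1 \<and> H ** G = 0"

text \<open>The hypotheses say that the square block matrix with rows \<open>H\<close> and
  \<open>adj G\<close> has the right inverse with columns \<open>adj H\<close> and \<open>G\<close>.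
  For square matrices a right inverse is a left inverse, and the reversed product is the
  claim.\<close>

lemma normalized_pair_complement:
  fixes G :: "complex ^ 'm::finite ^ ('p::finite + 'm)"
  assumes "normalized_pair G H"
  shows "adj H ** H + G ** adj G = mat 1"
proof -
  have GH: "adj G ** G = mat 1" "H ** adj H = mat 1" "H ** G = 0"
    using assms by (auto simp: normalized_pair_def)
  have "adj G ** adj H = adj (H ** G)"
    by (simp add: cnj.matrix_star_mult)
  also have "\<dots> = 0" by (simp add: GH vec_eq_iff)
  finally have "stack_matrix H (adj G) ** beside_matrix (adj H) G = mat 1"
    by (simp add: stack_mult_beside GH mat_one_blocks)
  then have "beside_matrix (adj H) G ** stack_matrix H (adj G) = mat 1"
    using matrix_left_right_inverse by blast
  then show ?thesis by (simp add: beside_mult_stack)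
qed

lemma normalized_pair_pythagoras:
  assumes "normalized_pair G H"
  shows "(norm (H *v x))\<^sup>2 + (norm (adj G *v x))\<^sup>2 = (norm x)\<^sup>2"
proof -
  have "(norm (H *v x))\<^sup>2 + (norm (adj G *v x))\<^sup>2 =
      inner x ((adj H ** H + G ** adj G) *v x)"
    by (simp add: norm_matrix_vector_square cnj.matrix_star_star inner_add_right
        matrix_vector_mult_add_rdistrib)
  then show ?thesis
    by (simp add: normalized_pair_complement[OF assms] power2_norm_eq_inner)
qed

lemma normalized_pair_contractions:
  assumes "normalized_pair G H"
  shows "norm (H *v x) \<le> norm x" "norm (adj G *v x) \<le> norm x"
    "norm (G *v y) = norm y" "norm (adj H *v z) = norm z"
proof -
  note p = normalized_pair_pythagoras[OF assms, of x]
  show "norm (H *v x) \<le> norm x" 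
    by (rule power2_le_imp_le) (use p zero_le_power2[of "norm (adj G *v x)"] in linarith, simp)
  show "norm (adj G *v x) \<le> norm x" 
    by (rule power2_le_imp_le) (use p zero_le_power2[of "norm (H *v x)"] in linarith, simp)
  show "norm (G *v y) = norm y" "norm (adj H *v z) = norm z"
    using assms by (auto simp: normalized_pair_def cnj.matrix_star_star intro!: norm_isometry)
qed

section \<open>The gap between two normalized pairs\<close>

lemma gap_pythagoras:
  assumes "normalized_pair G\<^sub>1 H\<^sub>1" "normalized_pair G\<^sub>2 H\<^sub>2"
  shows "(norm ((H\<^sub>2 ** G\<^sub>1) *v x))\<^sup>2 + (norm ((adj G\<^sub>2 ** G\<^sub>1) *v x))\<^sup>2 = (norm x)\<^sup>2"
  using normalized_pair_pythagoras[OF assms(2), of "G\<^sub>1 *v x"]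
    normalized_pair_contractions(3)[OF assms(1)]
  by (simp add: matrix_vector_mul_assoc)

lemma gap_le_one:
  assumes "normalized_pair G\<^sub>1 H\<^sub>1" "normalized_pair G\<^sub>2 H\<^sub>2"
  shows "norm ((H\<^sub>2 ** G\<^sub>1) *v x) \<le> norm x"
  by (rule power2_le_imp_le)
    (use gap_pythagoras[OF assms, of x] zero_le_power2[of "norm ((adj G\<^sub>2 ** G\<^sub>1) *v x)"] in linarith, simp)

text \<open>Squaring and \<open>gap_pythagoras\<close> trade an upper bound on one summand for a
  lower bound on the other.\<close>

lemma gap_bound_iff:
  assumes "normalized_pair G\<^sub>1 H\<^sub>1" "normalized_pair G\<^sub>2 H\<^sub>2" "0 \<le> a" "a \<le> 1"
  shows "norm ((H\<^sub>2 ** G\<^sub>1) *v x) \<le> a * norm x \<longleftrightarrow>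
    sqrt (1 - a\<^sup>2) * norm x \<le> norm ((adj G\<^sub>2 ** G\<^sub>1) *v x)"
proof -
  have a2: "a\<^sup>2 \<le> 1" using assms by (simp add: abs_square_le_1)
  have "norm ((H\<^sub>2 ** G\<^sub>1) *v x) \<le> a * norm x \<longleftrightarrow> (norm ((H\<^sub>2 ** G\<^sub>1) *v x))\<^sup>2 \<le> a\<^sup>2 * (norm x)\<^sup>2"
    using assms abs_le_square_iff[of "norm ((H\<^sub>2 ** G\<^sub>1) *v x)" "a * norm x"]
    by (simp add: power_mult_distrib)
  also have "\<dots> \<longleftrightarrow> (sqrt (1 - a\<^sup>2) * norm x)\<^sup>2 \<le> (norm ((adj G\<^sub>2 ** G\<^sub>1) *v x))\<^sup>2"
    using gap_pythagoras[OF assms(1,2), of x] a2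
    by (simp add: power_mult_distrib algebra_simps) linarith
  also have "\<dots> \<longleftrightarrow> sqrt (1 - a\<^sup>2) * norm x \<le> norm ((adj G\<^sub>2 ** G\<^sub>1) *v x)"
    using a2 abs_le_square_iff[of "sqrt (1 - a\<^sup>2) * norm x" "norm ((adj G\<^sub>2 ** G\<^sub>1) *v x)"]
    by (simp add: abs_mult)
  finally show ?thesis .
qed

text \<open>Symmetry of the gap rests on \<open>G\<^sub>2\<^sup>* G\<^sub>1\<close> being square: its lower bound passes to its adjoint.\<close>

lemma gap_symmetric:
  assumes "normalized_pair G\<^sub>1 H\<^sub>1" "normalized_pair G\<^sub>2 H\<^sub>2" "0 \<le> a"
    and "\<And>x. norm ((H\<^sub>2 ** G\<^sub>1) *v x) \<le> a * norm x"
  shows "norm ((H\<^sub>1 ** G\<^sub>2) *v x) \<le> a * norm x"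
proof (cases "a < 1")
  case True
  then have "0 < sqrt (1 - a\<^sup>2)" using assms(3) by (simp add: abs_square_less_1)
  moreover have "sqrt (1 - a\<^sup>2) * norm y \<le> norm ((adj G\<^sub>2 ** G\<^sub>1) *v y)" for y
    using gap_bound_iff[OF assms(1-3), of y] assms(4) True by simp
  ultimately have "sqrt (1 - a\<^sup>2) * norm x \<le> norm (adj (adj G\<^sub>2 ** G\<^sub>1) *v x)"
    by (rule norm_adj_ge)
  then show ?thesis
    using gap_bound_iff[OF assms(2,1,3), of x] True
    by (simp add: cnj.matrix_star_mult cnj.matrix_star_star)
next
  \<comment> \<open>For \<open>a \<ge> 1\<close> the lower bound degenerates, but contractivity
    already gives the claim.\<close>
  case False
  then have "norm x \<le> a * norm x" by (simp add: mult_le_cancel_right1)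
  then show ?thesis using gap_le_one[OF assms(2,1), of x] by linarith
qed

text \<open>The complement identity of the middle pair is inserted between \<open>H\<^sub>3\<close>
  and \<open>G\<^sub>1\<close>; the outer factors \<open>H\<^sub>3\<close>,
  \<open>adj H\<^sub>2\<close> and \<open>adj G\<^sub>2\<close> do not increase norms.\<close>

lemma gap_triangle:
  assumes "normalized_pair G\<^sub>1 H\<^sub>1" "normalized_pair G\<^sub>2 H\<^sub>2" "normalized_pair G\<^sub>3 H\<^sub>3" "0 \<le> b"
    and a: "\<And>x. norm ((H\<^sub>2 ** G\<^sub>1) *v x) \<le> a * norm x"
    and b: "\<And>x. norm ((H\<^sub>3 ** G\<^sub>2) *v x) \<le> b * norm x"
  shows "norm ((H\<^sub>3 ** G\<^sub>1) *v x) \<le> (a + b) * norm x"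
proof -
  let ?y = "G\<^sub>1 *v x"
  have "H\<^sub>3 *v ?y = H\<^sub>3 *v ((adj H\<^sub>2 ** H\<^sub>2 + G\<^sub>2 ** adj G\<^sub>2) *v ?y)"
    by (simp add: normalized_pair_complement[OF assms(2)])
  also have "\<dots> = H\<^sub>3 *v (adj H\<^sub>2 *v ((H\<^sub>2 ** G\<^sub>1) *v x)) + (H\<^sub>3 ** G\<^sub>2) *v (adj G\<^sub>2 *v ?y)"
    by (simp only: matrix_vector_mult_add_rdistrib matrix_vector_right_distrib
        matrix_vector_mul_assoc[symmetric])
  also have "norm \<dots> \<le> norm ((H\<^sub>2 ** G\<^sub>1) *v x) + b * norm (adj G\<^sub>2 *v ?y)"
    by (intro norm_triangle_mono b order_trans[OF normalized_pair_contractions(1)[OF assms(3)]])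
      (simp add: normalized_pair_contractions(4)[OF assms(2)])
  also have "\<dots> \<le> a * norm x + b * norm x"
    using normalized_pair_contractions(2)[OF assms(2), of ?y]
      normalized_pair_contractions(3)[OF assms(1), of x] assms(4)
    by (intro add_mono a mult_left_mono) auto
  finally show ?thesis by (simp add: matrix_vector_mul_assoc distrib_right)
qed

text \<open>At \<open>t = 1\<close> the matrix is \<open>G\<^sub>1\<^sup>* G\<^sub>3\<close>.\<close>

lemma homotopy_nonsingular:
  assumes "normalized_pair G\<^sub>1 H\<^sub>1" "normalized_pair G\<^sub>2 H\<^sub>2" "normalized_pair G\<^sub>3 H\<^sub>3"
    and nn: "0 \<le> a" "0 \<le> b" "a + b < 1" and t: "0 \<le> t" "t \<le> 1"
    and a: "\<And>x. norm ((H\<^sub>2 ** G\<^sub>1) *v x) \<le> a * norm x"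
    and b: "\<And>x. norm ((H\<^sub>3 ** G\<^sub>2) *v x) \<le> b * norm x"
  shows "det ((adj G\<^sub>1 ** G\<^sub>2) ** (adj G\<^sub>2 ** G\<^sub>3) + t *\<^sub>R (adj (H\<^sub>2 ** G\<^sub>1) ** (H\<^sub>2 ** G\<^sub>3))) \<noteq> 0"
    (is "det ?M \<noteq> 0")
proof -
  \<comment> \<open>On a kernel vector the two summands cancel, so the squared norm of
    \<open>(adj G\<^sub>1 ** G\<^sub>2) *v ?x\<close> is at most
    \<open>a\<^sup>2 * b\<^sup>2 * (norm v)\<^sup>2\<close>. Two Pythagorean identities bound it
    below by \<open>(1 - a\<^sup>2) * (1 - b\<^sup>2) * (norm v)\<^sup>2\<close>. Comparing them
    leaves \<open>(1 - a\<^sup>2 - b\<^sup>2) * (norm v)\<^sup>2 \<le> 0\<close>.\<close>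
  have "v = 0" if Mv: "?M *v v = 0" for v
  proof -
    let ?u = "(H\<^sub>2 ** G\<^sub>3) *v v" and ?x = "(adj G\<^sub>2 ** G\<^sub>3) *v v"
    have u: "norm ?u \<le> b * norm v"
      by (rule gap_symmetric[OF assms(2,3) nn(2) b])
    have x: "norm ((H\<^sub>1 ** G\<^sub>2) *v ?x) \<le> a * norm ?x"
      by (rule gap_symmetric[OF assms(1,2) nn(1) a])
    have "(adj G\<^sub>1 ** G\<^sub>2) *v ?x + t *\<^sub>R (adj (H\<^sub>2 ** G\<^sub>1) *v ?u) = 0"
      using Mv by (simp add: matrix_vector_mult_add_rdistrib matrix_vector_mul_assoc
          scaleR_matrix_vector_mult)
    then have "norm ((adj G\<^sub>1 ** G\<^sub>2) *v ?x) = norm (t *\<^sub>R (adj (H\<^sub>2 ** G\<^sub>1) *v ?u))"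
      by (metis add_eq_0_iff2 norm_minus_cancel)
    also have "\<dots> \<le> 1 * (a * norm ?u)"
      unfolding norm_scaleR using t by (intro mult_mono norm_adj_le a) auto
    also have "\<dots> \<le> a * (b * norm v)" using u nn by (simp add: mult_left_mono)
    finally have "norm ((adj G\<^sub>1 ** G\<^sub>2) *v ?x) \<le> a * b * norm v" by simp
    then have 1: "(norm ((adj G\<^sub>1 ** G\<^sub>2) *v ?x))\<^sup>2 \<le> a\<^sup>2 * b\<^sup>2 * (norm v)\<^sup>2"
      by (metis norm_ge_zero power_mono power_mult_distrib)
    have 2: "(norm ((H\<^sub>1 ** G\<^sub>2) *v ?x))\<^sup>2 \<le> a\<^sup>2 * (norm ?x)\<^sup>2"
      using power_mono[OF x, of 2] by (simp add: power_mult_distrib)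
    have 3: "(norm ?u)\<^sup>2 \<le> b\<^sup>2 * (norm v)\<^sup>2"
      using power_mono[OF u, of 2] by (simp add: power_mult_distrib)
    have 4: "(norm ((H\<^sub>1 ** G\<^sub>2) *v ?x))\<^sup>2 + (norm ((adj G\<^sub>1 ** G\<^sub>2) *v ?x))\<^sup>2 = (norm ?x)\<^sup>2"
      by (rule gap_pythagoras[OF assms(2,1)])
    have 5: "(norm ?u)\<^sup>2 + (norm ?x)\<^sup>2 = (norm v)\<^sup>2"
      by (rule gap_pythagoras[OF assms(3,2)])
    have a1: "a\<^sup>2 \<le> 1" using nn by (simp add: abs_square_le_1)
    have "(1 - a\<^sup>2) * ((1 - b\<^sup>2) * (norm v)\<^sup>2) \<le> (1 - a\<^sup>2) * (norm ?x)\<^sup>2"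
      using 3 5 a1 by (intro mult_left_mono) (auto simp: algebra_simps)
    also have "\<dots> \<le> a\<^sup>2 * b\<^sup>2 * (norm v)\<^sup>2"
      using 1 2 4 by (simp add: algebra_simps)
    finally have "(1 - a\<^sup>2 - b\<^sup>2) * (norm v)\<^sup>2 \<le> 0" by (simp add: algebra_simps)
    moreover have "a\<^sup>2 + b\<^sup>2 < 1"
    proof -
      have "a\<^sup>2 + b\<^sup>2 \<le> (a + b)\<^sup>2" using nn by (simp add: power2_sum)
      also have "\<dots> < 1" using nn by (simp add: abs_square_less_1)
      finally show ?thesis .
    qed
    ultimately show "v = 0" by (simp add: mult_le_0_iff)
  qed
  then have "invertible ?M"
    using matrix_left_invertible_ker[of ?M] invertible_left_inverse[of ?M] by blast
  then show ?thesis by (simp add: invertible_det_nz)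
qed

section \<open>Factorizations\<close>

lemma matrix_inv_invertible:
  assumes "invertible A"
  shows "A ** matrix_inv A = mat 1" "matrix_inv A ** A = mat 1"
  using someI_ex[OF assms[unfolded invertible_def]] unfolding matrix_inv_def by auto

lemma matrix_minus_mult_minus: "(- A) ** (- B) = A ** (B :: 'a::ring_1 ^ 'n::finite ^ 'k::finite)"
  by (simp add: vec_eq_iff matrix_matrix_mult_def)

lemma matrix_minus_mult: "(- A) ** B = - (A ** (B :: 'a::ring_1 ^ 'n::finite ^ 'k::finite))"
  by (simp add: vec_eq_iff matrix_matrix_mult_def sum_negf)

lemma matrix_add_rdistrib:
  "(A + B) ** C = A ** C + B ** (C :: 'a::semiring_1 ^ 'n::finite ^ 'k::finite)"
  by (simp add: vec_eq_iff matrix_matrix_mult_def sum.distrib distrib_right)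

interpretation fract: unital_ring_hom "\<lambda>x::'a::idom. Fract x 1"
  by unfold_locales (simp_all add: One_fract_def)

lemma inj_Fract_one: "inj (\<lambda>x::'a::idom. Fract x 1)"
  by (simp add: inj_def eq_fract)

lemma fract_matrix_eq_iff: "fract_matrix A = fract_matrix B \<longleftrightarrow> A = B"
  unfolding fract_matrix_def by (rule map_matrix_inj[OF inj_Fract_one])

lemmas fract_matrix_simps =
  fract.map_matrix_add[folded fract_matrix_def]
  fract.map_matrix_mult[folded fract_matrix_def]
  fract.map_matrix_one[folded fract_matrix_def]

lemma right_coprime_factorization_eq:
  assumes "right_coprime_factorization P N D"
  shows "P ** fract_matrix D = fract_matrix N"
  using assms matrix_inv_invertible[of "fract_matrix D"]
  unfolding right_coprime_factorization_def by (metis matrix_mul_assoc matrix_mul_rid)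

lemma left_coprime_factorization_eq:
  assumes "left_coprime_factorization P N D"
  shows "fract_matrix D ** P = fract_matrix N"
  using assms matrix_inv_invertible[of "fract_matrix D"]
  unfolding left_coprime_factorization_def by (metis matrix_mul_assoc matrix_mul_lid)

text \<open>Over the fraction field the factor is \<open>W\<close>, the inverse of \<open>D'\<close>
  times \<open>D\<close>. The Bezout identity of the second factorization expresses \<open>W\<close>
  as \<open>X ** N + Y ** D\<close>, which has entries in \<open>R\<close>.\<close>

lemma right_coprime_factor:
  assumes P: "right_coprime_factorization P N D" "right_coprime_factorization P N' D'"
  obtains U where "N = N' ** U" "D = D' ** U"
proof -
  let ?F = "fract_matrix"
  define W where "W = matrix_inv (?F D') ** ?F D"
  have D: "?F D' ** W = ?F D"
    using matrix_inv_invertible[of "?F D'"] P(2)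
    unfolding W_def right_coprime_factorization_def by (simp add: matrix_mul_assoc)
  have "?F N' ** W = P ** (?F D' ** W)"
    using right_coprime_factorization_eq[OF P(2)] by (simp add: matrix_mul_assoc)
  also have "\<dots> = ?F N"
    using right_coprime_factorization_eq[OF P(1)] by (simp add: D)
  finally have N: "?F N' ** W = ?F N" .
  obtain X Y where XY: "X ** N' + Y ** D' = mat 1"
    using P(2) unfolding right_coprime_factorization_def by blast
  define U where "U = X ** N + Y ** D"
  have "?F U = ?F X ** (?F N' ** W) + ?F Y ** (?F D' ** W)"
    by (simp add: U_def fract_matrix_simps N D)
  also have "\<dots> = ?F (X ** N' + Y ** D') ** W"
    by (simp add: fract_matrix_simps matrix_mul_assoc matrix_add_rdistrib)
  also have "\<dots> = W" by (simp add: XY fract_matrix_simps)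
  finally have "?F (N' ** U) = ?F N" "?F (D' ** U) = ?F D"
    by (simp_all add: fract_matrix_simps N D)
  then show ?thesis using that[of U] by (simp add: fract_matrix_eq_iff)
qed

text \<open>The factors \<open>U\<close> and \<open>V\<close> obtained in the two directions satisfy
  \<open>U ** V = mat 1\<close>, because the Bezout identity cancels the common left factor.\<close>

lemma right_coprime_factorization_unique:
  assumes P: "right_coprime_factorization P N D" "right_coprime_factorization P N' D'"
  obtains U where "N = N' ** U" "D = D' ** U" "det U \<in> inv_elems"
proof -
  obtain U where U: "N = N' ** U" "D = D' ** U" using right_coprime_factor[OF P] .
  obtain V where V: "N' = N ** V" "D' = D ** V" using right_coprime_factor[OF P(2,1)] .
  obtain X Y where XY: "X ** N' + Y ** D' = mat 1"
    using P(2) unfolding right_coprime_factorization_def by blast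
  have "mat 1 = X ** (N' ** U ** V) + Y ** (D' ** U ** V)"
    unfolding U(1,2)[symmetric] V(1,2)[symmetric] XY ..
  also have "\<dots> = (X ** N' + Y ** D') ** (U ** V)"
    by (simp add: matrix_mul_assoc matrix_add_rdistrib)
  finally have "mat 1 = U ** V" by (simp add: XY)
  from arg_cong[OF this, of det] have "1 = det U * det V" by (simp add: det_mul)
  then have "det U \<in> inv_elems"
    unfolding inv_elems_def by (simp add: dvdI)
  then show ?thesis using U that by blast
qed

lemma coprime_factorizations_intertwine:
  assumes "right_coprime_factorization P N D" "left_coprime_factorization P N' D'"
  shows "D' ** N = N' ** D"
proof -
  have "fract_matrix (D' ** N) = fract_matrix D' ** P ** fract_matrix D"
    using right_coprime_factorization_eq[OF assms(1)]
    by (simp add: fract_matrix_simps flip: matrix_mul_assoc)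
  also have "\<dots> = fract_matrix (N' ** D)"
    using left_coprime_factorization_eq[OF assms(2)] by (simp add: fract_matrix_simps)
  finally show ?thesis by (simp add: fract_matrix_eq_iff)
qed

text \<open>Both sides of \<open>eq\<close> are a plant multiplied by the invertible denominators,
  which can be cancelled. This gives definiteness of the metric.\<close>

lemma coprime_factorizations_eqI:
  assumes P: "right_coprime_factorization P N D" "left_coprime_factorization P' N' D'"
    and eq: "D' ** N = N' ** D"
  shows "P = P'"
proof -
  let ?F = "fract_matrix"
  have inv: "invertible (?F D)" "invertible (?F D')"
    using P unfolding right_coprime_factorization_def left_coprime_factorization_def by auto
  have "?F D' ** P ** ?F D = ?F (D' ** N)"
    using right_coprime_factorization_eq[OF P(1)]
    by (simp add: fract_matrix_simps flip: matrix_mul_assoc)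
  also have "\<dots> = ?F D' ** P' ** ?F D"
    using left_coprime_factorization_eq[OF P(2)] by (simp add: eq fract_matrix_simps)
  finally have "matrix_inv (?F D') ** (?F D' ** P ** ?F D) ** matrix_inv (?F D) =
      matrix_inv (?F D') ** (?F D' ** P' ** ?F D) ** matrix_inv (?F D)" by simp
  moreover have "matrix_inv (?F D') ** (?F D' ** Q ** ?F D) ** matrix_inv (?F D) = Q" for Q
  proof -
    have "matrix_inv (?F D') ** (?F D' ** Q ** ?F D) ** matrix_inv (?F D) =
        (matrix_inv (?F D') ** ?F D') ** Q ** (?F D ** matrix_inv (?F D))"
      by (simp only: matrix_mul_assoc)
    then show ?thesis by (simp add: matrix_inv_invertible inv)
  qed
  ultimately show ?thesis by simp
qed

section \<open>The supremum norm\<close>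

lemma character_hom:
  assumes "\<phi> \<in> max_ideal_space"
  shows "unital_ring_hom \<phi>"
proof -
  have h: "\<phi> (x + y) = \<phi> x + \<phi> y" "\<phi> (x * y) = \<phi> x * \<phi> y" for x y
    using assms by (auto simp: max_ideal_space_def)
  obtain x where "\<phi> x \<noteq> 0" using assms by (auto simp: max_ideal_space_def)
  moreover have "\<phi> x * \<phi> 1 = \<phi> x" using h(2)[of x 1] by simp
  ultimately have "\<phi> 1 = 1" by simp
  then show ?thesis using h by unfold_locales auto
qed

lemma character_scaleR:
  assumes "\<phi> \<in> max_ideal_space"
  shows "\<phi> (t *\<^sub>R x) = t *\<^sub>R \<phi> x"
proof -
  have "\<phi> (scaleC (complex_of_real t) x) = complex_of_real t * \<phi> x"
    using assms unfolding max_ideal_space_def by blast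
  then show ?thesis by (simp only: scaleC_of_real scaleR_conv_of_real)
qed

text \<open>A real \<open>SUP\<close> dominates its members only over a bounded set; contractivity
  at every character supplies the bound 1.\<close>

lemma onorm_le_matrix_norm_inf:
  assumes "\<And>\<phi> x. \<phi> \<in> max_ideal_space \<Longrightarrow> norm (map_matrix \<phi> M *v x) \<le> norm x"
    and \<phi>: "\<phi> \<in> max_ideal_space"
  shows "onorm ((*v) (map_matrix \<phi> M)) \<le> matrix_norm_inf M"
proof -
  have "onorm ((*v) (map_matrix \<psi> M)) \<le> 1" if "\<psi> \<in> max_ideal_space" for \<psi>
    by (rule onorm_bound) (use that assms(1) in auto)
  then have "bdd_above ((\<lambda>\<phi>. onorm ((*v) (map_matrix \<phi> M))) ` max_ideal_space)"
    by (intro bdd_aboveI[of _ 1]) auto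
  then show ?thesis
    unfolding matrix_norm_inf_def by (rule cSUP_upper[OF \<phi>])
qed

lemma matrix_norm_inf_nonneg:
  fixes M :: "'s::complex_comm_banach_algebra_1 ^ 'n::finite ^ 'k::finite"
  assumes "\<And>\<phi> x. \<phi> \<in> max_ideal_space \<Longrightarrow> norm (map_matrix \<phi> M *v x) \<le> norm x"
  shows "0 \<le> matrix_norm_inf M"
proof -
  obtain \<phi> :: "'s \<Rightarrow> complex" where \<phi>: "\<phi> \<in> max_ideal_space"
    using max_ideal_space_nonempty by blast
  have "0 \<le> onorm ((*v) (map_matrix \<phi> M))"
    by (rule onorm_pos_le) simp
  also have "\<dots> \<le> matrix_norm_inf M" by (rule onorm_le_matrix_norm_inf[OF assms \<phi>])
  finally show ?thesis .
qed

lemma matrix_norm_inf_le: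
  assumes "0 \<le> a" "\<And>\<phi> x. \<phi> \<in> max_ideal_space \<Longrightarrow> norm (map_matrix \<phi> M *v x) \<le> a * norm x"
  shows "matrix_norm_inf M \<le> a"
  unfolding matrix_norm_inf_def
  by (rule cSUP_least[OF max_ideal_space_nonempty]) (intro onorm_bound assms)

lemma matrix_norm_inf_bound:
  assumes "\<And>\<phi> x. \<phi> \<in> max_ideal_space \<Longrightarrow> norm (map_matrix \<phi> M *v x) \<le> norm x"
    and "\<phi> \<in> max_ideal_space"
  shows "norm (map_matrix \<phi> M *v x) \<le> matrix_norm_inf M * norm x"
proof -
  have "norm (map_matrix \<phi> M *v x) \<le> onorm ((*v) (map_matrix \<phi> M)) * norm x"
    by (rule onorm) simp
  also have "\<dots> \<le> matrix_norm_inf M * norm x"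
    by (intro mult_right_mono onorm_le_matrix_norm_inf assms) auto
  finally show ?thesis .
qed

section \<open>The nu-metric\<close>

locale symmetric_nu_setting = nu_metric_setting star emb \<iota>
  for star :: "'s::complex_comm_banach_algebra_1 \<Rightarrow> 's"
    and emb :: "'r::idom \<Rightarrow> 's" and \<iota> :: "'s \<Rightarrow> 'g::ab_group_add" +
  assumes symmetric: "symmetric_involution star"
begin

sublocale emb: unital_ring_hom emb
  by unfold_locales (simp_all add: emb_add emb_mult emb_one)

sublocale star: star_ring star
proof
  show "star 1 = 1" by (metis mult.right_neutral star_mult star_star)
qed (simp_all add: star_add star_mult star_star mult.commute)

abbreviation adjoint :: "'s ^ 'n::finite ^ 'k::finite \<Rightarrow> 's ^ 'k ^ 'n"
  where "adjoint \<equiv> matrix_star star"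

lemma character_adjoint:
  assumes "\<phi> \<in> max_ideal_space"
  shows "map_matrix \<phi> (adjoint A) = adj (map_matrix \<phi> A)"
  using symmetric assms by (simp add: symmetric_involution_def vec_eq_iff)

lemmas character_simps =
  character_adjoint unital_ring_hom.map_matrix_mult[OF character_hom]
  unital_ring_hom.map_matrix_one[OF character_hom]
  unital_ring_hom.map_matrix_zero[OF character_hom]
  unital_ring_hom.map_matrix_add[OF character_hom]

text \<open>Semisimplicity: an entry of the difference that all characters annihilate is 0.\<close>

lemma matrix_eqI:
  fixes A B :: "'s ^ 'n::finite ^ 'k::finite"
  assumes "\<And>\<phi>. \<phi> \<in> max_ideal_space \<Longrightarrow> map_matrix \<phi> A = map_matrix \<phi> B"
  shows "A = B"
proof -
  have "A $ i $ j - B $ i $ j = 0" for i j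
  proof (rule semisimple_eq_zero[OF semisimple])
    fix \<phi> :: "'s \<Rightarrow> complex" assume \<phi>: "\<phi> \<in> max_ideal_space"
    interpret unital_ring_hom \<phi> using character_hom[OF \<phi>] .
    have "\<phi> (A $ i $ j) = \<phi> (B $ i $ j)"
      using assms[OF \<phi>] by (simp add: vec_eq_iff)
    then show "\<phi> (A $ i $ j - B $ i $ j) = 0"
      using hom_add[of "A $ i $ j" "- B $ i $ j"] hom_minus by simp
  qed
  then show ?thesis by (simp add: vec_eq_iff)
qed

section \<open>Elements of index zero\<close>

definition index_zero :: "'s \<Rightarrow> bool" where
  "index_zero x \<longleftrightarrow> x \<in> inv_elems \<and> \<iota> x = 0"

lemma inv_elems_mult: "x * y \<in> inv_elems \<longleftrightarrow> x \<in> inv_elems \<and> y \<in> inv_elems"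
  for x y :: 's
  unfolding inv_elems_def mem_Collect_eq
  using dvd_mult_left[of x y 1] dvd_mult_right[of x y 1] mult_dvd_mono[of x 1 y 1] by auto

lemma index_zero_one: "index_zero 1"
  using index_mult[of 1 1] by (simp add: index_zero_def inv_elems_def)

lemma index_zero_mult: "index_zero x \<Longrightarrow> index_zero (x * y) \<longleftrightarrow> index_zero y"
  unfolding index_zero_def inv_elems_mult using index_mult[of x y] by auto

lemma index_zero_star: "index_zero (star x) \<longleftrightarrow> index_zero x"
proof -
  have "index_zero (star x)" if "index_zero x" for x
    using that index_star[of x] star.map_matrix_unit by (simp add: index_zero_def)
  then show ?thesis by (metis star_star)
qed

text \<open>Assumption (A4) enters here; through it a change of coprime factorization over
  \<open>R\<close> preserves the index condition.\<close>

lemma index_zero_emb: "u \<in> inv_elems \<Longrightarrow> index_zero (emb u)"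
  using emb.map_matrix_unit[of u] inv_iff_index[of u] by (simp add: index_zero_def)

text \<open>The path has a connected image, and a connected subset of a discrete space has at most
  one point, so the index is constant along it.\<close>

lemma index_zero_homotopy:
  fixes f :: "real \<Rightarrow> 's"
  assumes "continuous_on {0..1} f" "\<And>t. t \<in> {0..1} \<Longrightarrow> f t \<in> inv_elems"
  shows "index_zero (f 0) \<longleftrightarrow> index_zero (f 1)"
proof -
  have "connected (f ` {0..1})"
    using assms(1) by (intro connected_continuous_image) auto
  then have "connectedin (top_of_set inv_elems) (f ` {0..1})"
    using assms(2) by (auto simp: connectedin_subtopology)
  then have "connectedin (discrete_topology UNIV) (\<iota> ` f ` {0..1})"
    by (rule connectedin_continuous_map_image[OF index_continuous])
  then obtain c where "\<iota> ` f ` {0..1} \<subseteq> {c}"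
    by (auto simp: connectedin_discrete_topology)
  then have "\<iota> (f t) = c" if "t \<in> {0..1}" for t using that by blast
  from this[of 0] this[of 1] have "\<iota> (f 0) = c" "\<iota> (f 1) = c" by simp_all
  then show ?thesis using assms(2)[of 0] assms(2)[of 1] by (simp add: index_zero_def)
qed

section \<open>Symbols of a plant and the choice of factorizations\<close>

definition plant_symbols ::
    "'r fract ^ 'm::finite ^ 'p::finite \<Rightarrow> 's ^ 'm ^ ('p + 'm) \<Rightarrow> 's ^ ('p + 'm) ^ 'p \<Rightarrow> bool" where
  "plant_symbols P G H \<longleftrightarrow> (\<exists>N D N' D'.
     normalized_right_factorization star emb P N D \<and> G = right_symbol emb N D \<and>
     normalized_left_factorization star emb P N' D' \<and> H = left_symbol emb N' D')"

lemma normalized_plants_iff: "P \<in> normalized_plants star emb \<longleftrightarrow> (\<exists>G H. plant_symbols P G H)"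
  unfolding normalized_plants_def plant_symbols_def by blast

text \<open>\<open>dnu_value\<close> mentions no left factorization of \<open>P\<^sub>1\<close>; the
  hypothesis provides one, so that \<open>H\<^sub>1\<close> exists.\<close>

lemma dnu_value_iff:
  assumes "P\<^sub>1 \<in> normalized_plants star emb"
  shows "dnu_value star emb \<iota> P\<^sub>1 P\<^sub>2 r \<longleftrightarrow> (\<exists>G\<^sub>1 H\<^sub>1 G\<^sub>2 H\<^sub>2. plant_symbols P\<^sub>1 G\<^sub>1 H\<^sub>1 \<and>
    plant_symbols P\<^sub>2 G\<^sub>2 H\<^sub>2 \<and> r = dnu_formula star \<iota> G\<^sub>1 G\<^sub>2 H\<^sub>2)"
  using assms unfolding normalized_plants_def plant_symbols_def dnu_value_def by blast

lemma adjoint_right_symbol: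
  "adjoint (right_symbol emb N D) ** right_symbol emb N D =
     adjoint (map_matrix emb N) ** map_matrix emb N + adjoint (map_matrix emb D) ** map_matrix emb D"
  by (simp add: right_symbol_def matrix_star_stack beside_mult_stack)

lemma left_symbol_adjoint:
  "left_symbol emb N D ** adjoint (left_symbol emb N D) =
     map_matrix emb N ** adjoint (map_matrix emb N) + map_matrix emb D ** adjoint (map_matrix emb D)"
proof -
  have "adjoint (- map_matrix emb D) = - adjoint (map_matrix emb D)"
    by (simp add: vec_eq_iff star.hom_minus)
  then show ?thesis
    by (simp add: left_symbol_def matrix_star_beside beside_mult_stack matrix_minus_mult_minus add.commute)
qed

lemma left_symbol_mult_right_symbol:
  "left_symbol emb N' D' ** right_symbol emb N D = map_matrix emb (N' ** D) - map_matrix emb (D' ** N)"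
  unfolding left_symbol_def right_symbol_def beside_mult_stack matrix_minus_mult emb.map_matrix_mult
  by simp

lemma plant_symbolsD:
  assumes "plant_symbols P G H"
  shows "adjoint G ** G = mat 1" "H ** adjoint H = mat 1" "H ** G = 0"
  using assms
  unfolding plant_symbols_def normalized_right_factorization_def normalized_left_factorization_def
  by (auto simp: adjoint_right_symbol left_symbol_adjoint left_symbol_mult_right_symbol
      dest: coprime_factorizations_intertwine)

lemma plant_symbols_pair:
  assumes "plant_symbols P G H" "\<phi> \<in> max_ideal_space"
  shows "normalized_pair (map_matrix \<phi> G) (map_matrix \<phi> H)"
  using plant_symbolsD[OF assms(1), THEN arg_cong[where f = "map_matrix \<phi>"]] assms(2)
  by (simp add: normalized_pair_def character_simps)

lemma plant_symbols_eqI: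
  assumes "plant_symbols P\<^sub>1 G\<^sub>1 H\<^sub>1" "plant_symbols P\<^sub>2 G\<^sub>2 H\<^sub>2" "H\<^sub>2 ** G\<^sub>1 = 0"
  shows "P\<^sub>1 = P\<^sub>2"
proof -
  obtain N D where 1: "right_coprime_factorization P\<^sub>1 N D" "G\<^sub>1 = right_symbol emb N D"
    using assms(1) unfolding plant_symbols_def normalized_right_factorization_def by blast
  obtain N' D' where 2: "left_coprime_factorization P\<^sub>2 N' D'" "H\<^sub>2 = left_symbol emb N' D'"
    using assms(2) unfolding plant_symbols_def normalized_left_factorization_def by blast
  have "D' ** N = N' ** D"
    using assms(3) by (simp add: 1 2 left_symbol_mult_right_symbol map_matrix_inj[OF emb_inj])
  then show ?thesis using coprime_factorizations_eqI[OF 1(1) 2(1)] by simp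
qed

text \<open>The factor between two right coprime factorizations becomes unitary over
  \<open>S\<close> by normalization. Its determinant is the image of a unit of \<open>R\<close>,
  whence index zero.\<close>

lemma plant_symbols_unique:
  assumes "plant_symbols P G H" "plant_symbols P G' H'"
  obtains U where "G = G' ** U" "adjoint U ** U = mat 1" "index_zero (det U)"
proof -
  obtain N D where 1: "right_coprime_factorization P N D" "G = right_symbol emb N D"
    using assms(1) unfolding plant_symbols_def normalized_right_factorization_def by blast
  obtain N' D' where 2: "right_coprime_factorization P N' D'" "G' = right_symbol emb N' D'"
    using assms(2) unfolding plant_symbols_def normalized_right_factorization_def by blast
  obtain U where U: "N = N' ** U" "D = D' ** U" "det U \<in> inv_elems"
    using right_coprime_factorization_unique[OF 1(1) 2(1)] .
  let ?U = "map_matrix emb U"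
  have G: "G = G' ** ?U"
    by (simp add: 1 2 U(1,2) right_symbol_def stack_mult emb.map_matrix_mult)
  have "adjoint G ** G = adjoint ?U ** (adjoint G' ** G') ** ?U"
    by (simp add: G star.matrix_star_mult matrix_mul_assoc)
  then have "adjoint ?U ** ?U = mat 1"
    by (simp add: plant_symbolsD(1)[OF assms(1)] plant_symbolsD(1)[OF assms(2)])
  moreover have "index_zero (det ?U)"
    using index_zero_emb[OF U(3)] by (simp add: emb.map_matrix_det)
  ultimately show ?thesis using that G by blast
qed

lemma gap_norm_le_one:
  assumes "plant_symbols P\<^sub>1 G\<^sub>1 H\<^sub>1" "plant_symbols P\<^sub>2 G\<^sub>2 H\<^sub>2" "\<phi> \<in> max_ideal_space"
  shows "norm (map_matrix \<phi> (H\<^sub>2 ** G\<^sub>1) *v x) \<le> norm x"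
  using gap_le_one[OF assms(1,2)[THEN plant_symbols_pair, OF assms(3)]] assms(3)
  by (simp add: character_simps)

lemma gap_norm:
  assumes "plant_symbols P\<^sub>1 G\<^sub>1 H\<^sub>1" "plant_symbols P\<^sub>2 G\<^sub>2 H\<^sub>2"
  shows "0 \<le> matrix_norm_inf (H\<^sub>2 ** G\<^sub>1)" "matrix_norm_inf (H\<^sub>2 ** G\<^sub>1) \<le> 1"
    "\<phi> \<in> max_ideal_space \<Longrightarrow>
       norm ((map_matrix \<phi> H\<^sub>2 ** map_matrix \<phi> G\<^sub>1) *v x) \<le> matrix_norm_inf (H\<^sub>2 ** G\<^sub>1) * norm x"
proof -
  note le = gap_norm_le_one[OF assms]
  show "0 \<le> matrix_norm_inf (H\<^sub>2 ** G\<^sub>1)" by (rule matrix_norm_inf_nonneg[OF le])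
  show "matrix_norm_inf (H\<^sub>2 ** G\<^sub>1) \<le> 1" by (rule matrix_norm_inf_le) (simp_all add: le)
  show "norm ((map_matrix \<phi> H\<^sub>2 ** map_matrix \<phi> G\<^sub>1) *v x) \<le> matrix_norm_inf (H\<^sub>2 ** G\<^sub>1) * norm x"
    if "\<phi> \<in> max_ideal_space"
    using matrix_norm_inf_bound[OF le that, of x] that by (simp add: character_simps)
qed

lemma gap_norm_leI:
  assumes "0 \<le> a" "\<And>\<phi> x. \<phi> \<in> max_ideal_space \<Longrightarrow>
    norm ((map_matrix \<phi> H\<^sub>2 ** map_matrix \<phi> G\<^sub>1) *v x) \<le> a * norm x"
  shows "matrix_norm_inf (H\<^sub>2 ** G\<^sub>1) \<le> a"
  by (rule matrix_norm_inf_le) (use assms in \<open>simp_all add: character_simps\<close>)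

text \<open>By the Pythagorean identity the norm of \<open>H\<^sub>2 x\<close> is determined by \<open>G\<^sub>2\<close>, so uniqueness of left
  factorizations is not needed.\<close>

lemma gap_norm_invariant:
  assumes "plant_symbols P\<^sub>1 G\<^sub>1 H\<^sub>1" "plant_symbols P\<^sub>2 G\<^sub>2 H\<^sub>2"
    and "plant_symbols P\<^sub>1 G\<^sub>1' H\<^sub>1'" "plant_symbols P\<^sub>2 G\<^sub>2' H\<^sub>2'"
  shows "matrix_norm_inf (H\<^sub>2 ** G\<^sub>1) \<le> matrix_norm_inf (H\<^sub>2' ** G\<^sub>1')"
proof (rule gap_norm_leI)
  show "0 \<le> matrix_norm_inf (H\<^sub>2' ** G\<^sub>1')" by (rule gap_norm[OF assms(3,4)])
  obtain U where U: "G\<^sub>1 = G\<^sub>1' ** U" "adjoint U ** U = mat 1"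
    using plant_symbols_unique[OF assms(1,3)] .
  fix \<phi> :: "'s \<Rightarrow> complex" and x assume \<phi>: "\<phi> \<in> max_ideal_space"
  \<comment> \<open>\<open>plant_symbols\<close> chooses its right and left factorizations
    independently, so symbols of one plant may be recombined.\<close>
  have mixed: "plant_symbols P\<^sub>2 G\<^sub>2 H\<^sub>2'"
    using assms(2,4) unfolding plant_symbols_def by blast
  have same: "norm (map_matrix \<phi> H\<^sub>2 *v y) = norm (map_matrix \<phi> H\<^sub>2' *v y)" for y
    using normalized_pair_pythagoras[OF plant_symbols_pair[OF assms(2) \<phi>], of y]
      normalized_pair_pythagoras[OF plant_symbols_pair[OF mixed \<phi>], of y]
    by (metis add_right_cancel norm_ge_zero power2_eq_imp_eq)
  have "adj (map_matrix \<phi> U) ** map_matrix \<phi> U = mat 1"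
    using arg_cong[OF U(2), of "map_matrix \<phi>"] \<phi> by (simp add: character_simps)
  then have iso: "norm (map_matrix \<phi> U *v x) = norm x" by (rule norm_isometry)
  have "norm ((map_matrix \<phi> H\<^sub>2 ** map_matrix \<phi> G\<^sub>1) *v x) =
      norm ((map_matrix \<phi> H\<^sub>2' ** map_matrix \<phi> G\<^sub>1') *v (map_matrix \<phi> U *v x))"
    using \<phi> same by (simp add: U(1) character_simps flip: matrix_vector_mul_assoc)
  also have "\<dots> \<le> matrix_norm_inf (H\<^sub>2' ** G\<^sub>1') * norm x"
    using gap_norm(3)[OF assms(3,4) \<phi>, of "map_matrix \<phi> U *v x"] by (simp add: iso)
  finally show "norm ((map_matrix \<phi> H\<^sub>2 ** map_matrix \<phi> G\<^sub>1) *v x) \<le>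
      matrix_norm_inf (H\<^sub>2' ** G\<^sub>1') * norm x" .
qed

text \<open>Changing the factorizations multiplies the determinant by
  \<open>star (det U) * det V\<close>, a factor of index zero.\<close>

lemma index_condition_invariant:
  assumes "plant_symbols P\<^sub>1 G\<^sub>1 H\<^sub>1" "plant_symbols P\<^sub>2 G\<^sub>2 H\<^sub>2"
    and "plant_symbols P\<^sub>1 G\<^sub>1' H\<^sub>1'" "plant_symbols P\<^sub>2 G\<^sub>2' H\<^sub>2'"
  shows "index_zero (det (adjoint G\<^sub>1 ** G\<^sub>2)) \<longleftrightarrow> index_zero (det (adjoint G\<^sub>1' ** G\<^sub>2'))"
proof -
  obtain U where U: "G\<^sub>1 = G\<^sub>1' ** U" "index_zero (det U)"
    using plant_symbols_unique[OF assms(1,3)] .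
  obtain V where V: "G\<^sub>2 = G\<^sub>2' ** V" "index_zero (det V)"
    using plant_symbols_unique[OF assms(2,4)] .
  have "adjoint G\<^sub>1 ** G\<^sub>2 = adjoint U ** (adjoint G\<^sub>1' ** G\<^sub>2') ** V"
    by (simp add: U V star.matrix_star_mult matrix_mul_assoc)
  then have "det (adjoint G\<^sub>1 ** G\<^sub>2) = star (det U) * (det V * det (adjoint G\<^sub>1' ** G\<^sub>2'))"
    by (simp add: det_mul star.det_matrix_star ac_simps)
  then show ?thesis using U V by (simp add: index_zero_mult index_zero_star)
qed

lemma dnu_formula_index_zero:
  "dnu_formula star \<iota> G\<^sub>1 G\<^sub>2 H\<^sub>2 =
     (if index_zero (det (adjoint G\<^sub>1 ** G\<^sub>2)) then matrix_norm_inf (H\<^sub>2 ** G\<^sub>1) else 1)"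
  by (simp add: dnu_formula_def index_zero_def)

lemma dnu_formula_invariant:
  assumes "plant_symbols P\<^sub>1 G\<^sub>1 H\<^sub>1" "plant_symbols P\<^sub>2 G\<^sub>2 H\<^sub>2"
    and "plant_symbols P\<^sub>1 G\<^sub>1' H\<^sub>1'" "plant_symbols P\<^sub>2 G\<^sub>2' H\<^sub>2'"
  shows "dnu_formula star \<iota> G\<^sub>1 G\<^sub>2 H\<^sub>2 = dnu_formula star \<iota> G\<^sub>1' G\<^sub>2' H\<^sub>2'"
  using index_condition_invariant[OF assms] gap_norm_invariant[OF assms]
    gap_norm_invariant[OF assms(3,4,1,2)]
  by (simp add: dnu_formula_index_zero)

lemma dnu_value_unique:
  assumes "P\<^sub>1 \<in> normalized_plants star emb" "P\<^sub>2 \<in> normalized_plants star emb"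
  shows "\<exists>!r. dnu_value star emb \<iota> P\<^sub>1 P\<^sub>2 r"
proof -
  obtain G\<^sub>1 H\<^sub>1 G\<^sub>2 H\<^sub>2 where "plant_symbols P\<^sub>1 G\<^sub>1 H\<^sub>1" "plant_symbols P\<^sub>2 G\<^sub>2 H\<^sub>2"
    using assms unfolding normalized_plants_iff by blast
  then show ?thesis
    unfolding dnu_value_iff[OF assms(1)] using dnu_formula_invariant by blast
qed

text \<open>Removes the description operator: from here on any symbols of the two plants may be
  used.\<close>

lemma dnu_eq:
  assumes "plant_symbols P\<^sub>1 G\<^sub>1 H\<^sub>1" "plant_symbols P\<^sub>2 G\<^sub>2 H\<^sub>2"
  shows "dnu star emb \<iota> P\<^sub>1 P\<^sub>2 =
    (if index_zero (det (adjoint G\<^sub>1 ** G\<^sub>2)) then matrix_norm_inf (H\<^sub>2 ** G\<^sub>1) else 1)"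
proof -
  have P: "P\<^sub>1 \<in> normalized_plants star emb" "P\<^sub>2 \<in> normalized_plants star emb"
    using assms unfolding normalized_plants_iff by blast+
  have "dnu_value star emb \<iota> P\<^sub>1 P\<^sub>2 (dnu_formula star \<iota> G\<^sub>1 G\<^sub>2 H\<^sub>2)"
    using assms unfolding dnu_value_iff[OF P(1)] by blast
  then have "(THE r. dnu_value star emb \<iota> P\<^sub>1 P\<^sub>2 r) = dnu_formula star \<iota> G\<^sub>1 G\<^sub>2 H\<^sub>2"
    using dnu_value_unique[OF P] by (rule the1_equality[rotated])
  then show ?thesis using P by (simp add: dnu_def dnu_formula_index_zero)
qed

lemma gap_norm_symmetric:
  assumes "plant_symbols P\<^sub>1 G\<^sub>1 H\<^sub>1" "plant_symbols P\<^sub>2 G\<^sub>2 H\<^sub>2"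
  shows "matrix_norm_inf (H\<^sub>1 ** G\<^sub>2) = matrix_norm_inf (H\<^sub>2 ** G\<^sub>1)"
proof -
  have le: "matrix_norm_inf (H\<^sub>1 ** G\<^sub>2) \<le> matrix_norm_inf (H\<^sub>2 ** G\<^sub>1)"
    if "plant_symbols P\<^sub>1 G\<^sub>1 H\<^sub>1" "plant_symbols P\<^sub>2 G\<^sub>2 H\<^sub>2"
    for P\<^sub>1 P\<^sub>2 :: "'r fract ^ 'm ^ 'p" and G\<^sub>1 H\<^sub>1 G\<^sub>2 H\<^sub>2
  proof (rule gap_norm_leI)
    fix \<phi> :: "'s \<Rightarrow> complex" and x assume \<phi>: "\<phi> \<in> max_ideal_space"
    show "norm ((map_matrix \<phi> H\<^sub>1 ** map_matrix \<phi> G\<^sub>2) *v x) \<le> matrix_norm_inf (H\<^sub>2 ** G\<^sub>1) * norm x"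
      by (rule gap_symmetric[OF plant_symbols_pair[OF that(1) \<phi>] plant_symbols_pair[OF that(2) \<phi>]
            gap_norm(1)[OF that] gap_norm(3)[OF that \<phi>]])
  qed (rule gap_norm(1)[OF that])
  show ?thesis using le[OF assms] le[OF assms(2,1)] by simp
qed

lemma index_condition_symmetric:
  "index_zero (det (adjoint G\<^sub>2 ** G\<^sub>1)) \<longleftrightarrow> index_zero (det (adjoint G\<^sub>1 ** G\<^sub>2))"
proof -
  have "det (adjoint G\<^sub>2 ** G\<^sub>1) = star (det (adjoint G\<^sub>1 ** G\<^sub>2))"
    by (simp add: star.matrix_star_mult star.matrix_star_star flip: star.det_matrix_star)
  then show ?thesis by (simp add: index_zero_star)
qed

lemma index_condition_trans:
  fixes G\<^sub>1 :: "'s ^ 'm::finite ^ ('p::finite + 'm)"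
  assumes P: "plant_symbols P\<^sub>1 G\<^sub>1 H\<^sub>1" "plant_symbols P\<^sub>2 G\<^sub>2 H\<^sub>2" "plant_symbols P\<^sub>3 G\<^sub>3 H\<^sub>3"
    and index: "index_zero (det (adjoint G\<^sub>1 ** G\<^sub>2))" "index_zero (det (adjoint G\<^sub>2 ** G\<^sub>3))"
    and less: "matrix_norm_inf (H\<^sub>2 ** G\<^sub>1) + matrix_norm_inf (H\<^sub>3 ** G\<^sub>2) < 1"
  shows "index_zero (det (adjoint G\<^sub>1 ** G\<^sub>3))"
proof -
  define A where "A = (adjoint G\<^sub>1 ** G\<^sub>2) ** (adjoint G\<^sub>2 ** G\<^sub>3)"
  define E where "E = adjoint (H\<^sub>2 ** G\<^sub>1) ** (H\<^sub>2 ** G\<^sub>3)"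
  define f where "f t = det (A + t *\<^sub>R E)" for t
  \<comment> \<open>The complement identity holds at every character and lifts to \<open>S\<close>
    by semisimplicity. Inserted between \<open>adjoint G\<^sub>1\<close> and
    \<open>G\<^sub>3\<close> it splits their product into \<open>A + E\<close>.\<close>
  have "adjoint H\<^sub>2 ** H\<^sub>2 + G\<^sub>2 ** adjoint G\<^sub>2 = mat 1"
    by (rule matrix_eqI)
      (simp add: character_simps normalized_pair_complement[OF plant_symbols_pair[OF P(2)]])
  then have "adjoint G\<^sub>1 ** (adjoint H\<^sub>2 ** H\<^sub>2 + G\<^sub>2 ** adjoint G\<^sub>2) ** G\<^sub>3 = adjoint G\<^sub>1 ** G\<^sub>3"
    by simp
  then have "A + E = adjoint G\<^sub>1 ** G\<^sub>3"
    by (simp add: A_def E_def star.matrix_star_mult matrix_add_ldistrib matrix_add_rdistrib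
        matrix_mul_assoc add.commute)
  then have f1: "f 1 = det (adjoint G\<^sub>1 ** G\<^sub>3)" by (simp add: f_def)
  have "f 0 = det (adjoint G\<^sub>1 ** G\<^sub>2) * det (adjoint G\<^sub>2 ** G\<^sub>3)"
    by (simp add: f_def A_def det_mul)
  then have f0: "index_zero (f 0)" using index by (simp add: index_zero_mult)
  have "f t \<in> inv_elems" if t: "t \<in> {0..1}" for t
  proof (rule invertible_if_characters_nonzero)
    fix \<phi> :: "'s \<Rightarrow> complex" assume \<phi>: "\<phi> \<in> max_ideal_space"
    have "map_matrix \<phi> (t *\<^sub>R E) = t *\<^sub>R map_matrix \<phi> E"
      by (simp add: vec_eq_iff character_scaleR[OF \<phi>])
    then have "\<phi> (f t) = det (map_matrix \<phi> A + t *\<^sub>R map_matrix \<phi> E)"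
      using \<phi> by (simp add: f_def unital_ring_hom.map_matrix_det[OF character_hom] character_simps)
    also have "\<dots> \<noteq> 0"
      unfolding A_def E_def character_simps[OF \<phi>]
      using homotopy_nonsingular[OF plant_symbols_pair[OF P(1) \<phi>] plant_symbols_pair[OF P(2) \<phi>]
          plant_symbols_pair[OF P(3) \<phi>] gap_norm(1)[OF P(1,2)] gap_norm(1)[OF P(2,3)] less _ _
          gap_norm(3)[OF P(1,2) \<phi>] gap_norm(3)[OF P(2,3) \<phi>]] t
      by simp
    finally show "\<phi> (f t) \<noteq> 0" .
  qed
  moreover have "continuous_on {0..1} f"
    unfolding f_def det_def by (simp, intro continuous_intros)
  ultimately show ?thesis using index_zero_homotopy[of f] f0 f1 by simp
qed

lemma metric: "Metric_space (normalized_plants star emb :: ('r fract ^ 'm::finite ^ 'p::finite) set)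
  (dnu star emb \<iota>)"
proof
  fix P\<^sub>1 P\<^sub>2 P\<^sub>3 :: "'r fract ^ 'm ^ 'p"
  let ?M = "normalized_plants star emb :: ('r fract ^ 'm ^ 'p) set"
  let ?d = "dnu star emb \<iota> :: 'r fract ^ 'm ^ 'p \<Rightarrow> 'r fract ^ 'm ^ 'p \<Rightarrow> real"
  show "0 \<le> ?d P\<^sub>1 P\<^sub>2"
  proof (cases "P\<^sub>1 \<in> ?M \<and> P\<^sub>2 \<in> ?M")
    case True
    then obtain G\<^sub>1 H\<^sub>1 G\<^sub>2 H\<^sub>2 where P: "plant_symbols P\<^sub>1 G\<^sub>1 H\<^sub>1" "plant_symbols P\<^sub>2 G\<^sub>2 H\<^sub>2"
      unfolding normalized_plants_iff by blast
    then show ?thesis using gap_norm[OF P] by (simp add: dnu_eq[OF P])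
  qed (auto simp: dnu_def)
  show "?d P\<^sub>1 P\<^sub>2 = ?d P\<^sub>2 P\<^sub>1"
  proof (cases "P\<^sub>1 \<in> ?M \<and> P\<^sub>2 \<in> ?M")
    case True
    then obtain G\<^sub>1 H\<^sub>1 G\<^sub>2 H\<^sub>2 where P: "plant_symbols P\<^sub>1 G\<^sub>1 H\<^sub>1" "plant_symbols P\<^sub>2 G\<^sub>2 H\<^sub>2"
      unfolding normalized_plants_iff by blast
    then show ?thesis
      using gap_norm_symmetric[OF P] index_condition_symmetric[of G\<^sub>2 G\<^sub>1]
      by (simp add: dnu_eq[OF P] dnu_eq[OF P(2,1)])
  qed (auto simp: dnu_def)
  assume M: "P\<^sub>1 \<in> ?M" "P\<^sub>2 \<in> ?M"
  then obtain G\<^sub>1 H\<^sub>1 G\<^sub>2 H\<^sub>2 where P: "plant_symbols P\<^sub>1 G\<^sub>1 H\<^sub>1" "plant_symbols P\<^sub>2 G\<^sub>2 H\<^sub>2"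
    unfolding normalized_plants_iff by blast
  show "?d P\<^sub>1 P\<^sub>2 = 0 \<longleftrightarrow> P\<^sub>1 = P\<^sub>2"
  proof
    assume "?d P\<^sub>1 P\<^sub>2 = 0"
    then have z: "matrix_norm_inf (H\<^sub>2 ** G\<^sub>1) = 0"
      by (simp add: dnu_eq[OF P] split: if_splits)
    have "H\<^sub>2 ** G\<^sub>1 = 0"
    proof (rule matrix_eqI)
      fix \<phi> :: "'s \<Rightarrow> complex" assume \<phi>: "\<phi> \<in> max_ideal_space"
      have "(map_matrix \<phi> H\<^sub>2 ** map_matrix \<phi> G\<^sub>1) *v x = 0" for x
        using gap_norm(3)[OF P \<phi>, of x] z by simp
      then have "map_matrix \<phi> H\<^sub>2 ** map_matrix \<phi> G\<^sub>1 = 0"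
        by (simp add: matrix_eq)
      then show "map_matrix \<phi> (H\<^sub>2 ** G\<^sub>1) = map_matrix \<phi> 0"
        by (simp add: character_simps[OF \<phi>])
    qed
    then show "P\<^sub>1 = P\<^sub>2" by (rule plant_symbols_eqI[OF P])
  next
    assume "P\<^sub>1 = P\<^sub>2"
    have "matrix_norm_inf (H\<^sub>1 ** G\<^sub>1) \<le> 0"
      by (rule matrix_norm_inf_le)
        (simp_all add: plant_symbolsD(3)[OF P(1)] character_simps)
    then have "matrix_norm_inf (H\<^sub>1 ** G\<^sub>1) = 0"
      using gap_norm(1)[OF P(1) P(1)] by simp
    then show "?d P\<^sub>1 P\<^sub>2 = 0"
      using dnu_eq[OF P(1) P(1)] \<open>P\<^sub>1 = P\<^sub>2\<close> plant_symbolsD(1)[OF P(1)] index_zero_one by simp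
  qed
  assume "P\<^sub>3 \<in> ?M"
  then obtain G\<^sub>3 H\<^sub>3 where P3: "plant_symbols P\<^sub>3 G\<^sub>3 H\<^sub>3"
    unfolding normalized_plants_iff by blast
  note d = dnu_eq[OF P] dnu_eq[OF P(2) P3] dnu_eq[OF P(1) P3]
  note n = gap_norm(1,2)[OF P] gap_norm(1,2)[OF P(2) P3] gap_norm(1,2)[OF P(1) P3]
  show "?d P\<^sub>1 P\<^sub>3 \<le> ?d P\<^sub>1 P\<^sub>2 + ?d P\<^sub>2 P\<^sub>3"
  \<comment> \<open>All distances are at most 1, so only a sum below 1 matters. In that case neither
    summand can be the default value 1, and both index conditions hold.\<close>
  proof (cases "?d P\<^sub>1 P\<^sub>2 + ?d P\<^sub>2 P\<^sub>3 < 1")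
    case True
    then have idx: "index_zero (det (adjoint G\<^sub>1 ** G\<^sub>2))" "index_zero (det (adjoint G\<^sub>2 ** G\<^sub>3))"
      using n unfolding d by (auto split: if_splits)
    have "matrix_norm_inf (H\<^sub>3 ** G\<^sub>1) \<le> matrix_norm_inf (H\<^sub>2 ** G\<^sub>1) + matrix_norm_inf (H\<^sub>3 ** G\<^sub>2)"
    proof (rule gap_norm_leI)
      show "0 \<le> matrix_norm_inf (H\<^sub>2 ** G\<^sub>1) + matrix_norm_inf (H\<^sub>3 ** G\<^sub>2)"
        using gap_norm(1)[OF P] gap_norm(1)[OF P(2) P3] by simp
      fix \<phi> :: "'s \<Rightarrow> complex" and x assume \<phi>: "\<phi> \<in> max_ideal_space"
      show "norm ((map_matrix \<phi> H\<^sub>3 ** map_matrix \<phi> G\<^sub>1) *v x) \<le>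
          (matrix_norm_inf (H\<^sub>2 ** G\<^sub>1) + matrix_norm_inf (H\<^sub>3 ** G\<^sub>2)) * norm x"
        by (rule gap_triangle[OF plant_symbols_pair[OF P(1) \<phi>] plant_symbols_pair[OF P(2) \<phi>]
              plant_symbols_pair[OF P3 \<phi>] gap_norm(1)[OF P(2) P3]
              gap_norm(3)[OF P \<phi>] gap_norm(3)[OF P(2) P3 \<phi>]])
    qed
    moreover have "index_zero (det (adjoint G\<^sub>1 ** G\<^sub>3))"
      using index_condition_trans[OF P P3 idx] True idx by (simp add: d)
    ultimately show ?thesis using idx by (simp add: d)
  next
    case False
    have "?d P\<^sub>1 P\<^sub>3 \<le> 1" using n by (simp add: d)
    then show ?thesis using False by linarith
  qed
qed

end

text \<open>The first conjunct is well-definedness: it shows that the \<open>THE\<close> in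
  \<open>dnu\<close> denotes the value given by every choice of normalized factorizations.\<close>

theorem theorem2p11:
  fixes star :: "'s::complex_comm_banach_algebra_1 \<Rightarrow> 's"
    and emb :: "'r::idom \<Rightarrow> 's"
    and \<iota> :: "'s \<Rightarrow> 'g::ab_group_add"
  assumes "nu_metric_setting star emb \<iota>"
    and "symmetric_involution star"
  shows "(\<forall>P\<^sub>1 \<in> normalized_plants star emb. \<forall>P\<^sub>2 \<in> normalized_plants star emb.
            \<exists>!r. dnu_value star emb \<iota> P\<^sub>1 (P\<^sub>2 :: 'r fract ^ 'm::finite ^ 'p::finite) r) \<and>
         Metric_space (normalized_plants star emb :: ('r fract ^ 'm ^ 'p) set) (dnu star emb \<iota>)"
proof -
  interpret symmetric_nu_setting star emb \<iota>
    using assms by (simp add: symmetric_nu_setting_def symmetric_nu_setting_axioms_def)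
  show ?thesis using dnu_value_unique metric by blast
qed

end
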